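(* Fix an integer $n \geq 3$ and put $N := \binom{n}{\lfloor n/2 \rfloor}$. Let $\mathbf{v}_1, \dots, \mathbf{v}_N \in \{0,1\}^n$ be the ballot directions (which depend only on $n$ and not on the ring). For any nonzero unital commutative ring $R$ and any multi-affine map $f : R^n \to R$, each assertion below implies the next: (1) $f$ is affine-linear on all of $R^n$. (2) $f|_{R\mathbf{v}}$ is affine-linear for all directions $\mathbf{v} \in R^n$; that is, $f(r\mathbf{v}) = f(0) + r\, m_{\mathbf{v}}$ for all $r \in R$, where $m_{\mathbf{v}} = f(\mathbf{v}) - f(0)$. (3) $f|_{R\mathbf{v}_i}$ is affine-linear for each ballot direction $\mathbf{v}_i$, $1 \leq i \leq N$. Moreover, the following dichotomy holds: (a) If $R$ is $n$-Vandermonde full, then for every multi-affine $f : R^n \to R$ the assertions (1), (2), (3) are equivalent. Moreover, $N$ is the best possible bound: for every $m < N$ and all $\mathbf{w}_1,\dots,\mathbf{w}_m \in R^n$, there is a multi-affine map $f : R^n \to R$ that is affine-linear on each $R\mathbf{w}_i$ but not affine-linear on $R^n$. (b) If $R$ is not $n$-Vandermonde full and additionally $R \in \mathfrak{R}$, then the assertions are not equivalent; more strongly, (2) does not imply (1), i.e. there exists a multi-affine map $f : R^n \to R$ such that $f|_{R\mathbf{v}}$ is affine-linear for all $\mathbf{v} \in R^n$ but $f$ is not affine-linear on $R^n$.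
   Context: Multi-affine and affine-linear: a map $f : R^n \to R$ is multi-affine if there are scalars $a_J \in R$ ($J \subseteq [n] := \{1,\dots,n\}$) with $f(\mathbf{x}) = \sum_{J \subseteq [n]} a_J \prod_{j \in J} x_j$ for all $\mathbf{x} \in R^n$. For $\mathbf{v} \in R^n$, $f|_{R\mathbf{v}}$ is affine-linear if there is $m_{\mathbf{v}} \in R$ with $f(r\mathbf{v}) = f(0) + r\, m_{\mathbf{v}}$ for all $r \in R$. The map $f$ is affine-linear on $R^n$ if there are $a_1,\dots,a_n \in R$ with $f(c_1,\dots,c_n) = f(0) + \sum_{i=1}^n a_i c_i$ for all $c_1,\dots,c_n \in R$. Ballot directions: a set $B = \{x_1 < \cdots < x_k\} \subseteq [n]$ is a ballot set if $x_i \geq 2i$ for all $1 \leq i \leq k$ (the empty set is ballot). There are exactly $N = \binom{n}{\lfloor n/2\rfloor}$ ballot subsets of $[n]$; call them $B_1, \dots, B_N$. The ballot directions are the vectors $\mathbf{v}_i \in \{0,1\}^n$ (regarded in $R^n$) whose $j$th coordinate is $1$ if $j \in [n] \setminus B_i$ and $0$ if $j \in B_i$. Vandermonde fullness: let $p_n(\mathbf{x}) := \prod_{j=1}^n x_j \cdot \prod_{1 \leq j < k \leq n} (x_j - x_k) \in R[x_1,\dots,x_n]$, and let $I_{p_n} = I_{p_n}(R)$ be the ideal of $R$ generated by $\{p_n(\mathbf{r}) : \mathbf{r} \in R^n\}$. The ring $R$ is $n$-Vandermonde full if $\mathrm{Ann}_R(I_{p_n}) = 0$. The class $\mathfrak{R}$: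 for a unital commutative ring $S$, let $ZD(S)$ be its set of zerodivisors ($0$ counts as a zerodivisor), and let $Q(S) := (S \setminus ZD(S))^{-1} S$ be its total ring of fractions. A unital commutative ring is Kasch if each of its maximal ideals has nonzero annihilator. The class $\mathfrak{R}$ consists of all products $\prod_{i \in I} R_i$ where $I$ is a nonempty (possibly infinite) index set and each $R_i$ is a unital commutative ring such that $Q(R_i)$ is Kasch. *)

theory Defs
  imports "HOL-Algebra.QuotRing"
begin

section \<open>Multi-affine maps on free modules\<close>

text \<open>The module \<open>R\<^sup>n\<close> is the set of extensional functions \<open>{1..n} \<rightarrow> carrier R\<close>; the values of a map
  outside this set are irrelevant.\<close>

definition vecs :: "('a, 'm) ring_scheme \<Rightarrow> nat \<Rightarrow> (nat \<Rightarrow> 'a) set" where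
  "vecs R n = {1..n} \<rightarrow>\<^sub>E carrier R"

definition zero_vec :: "('a, 'm) ring_scheme \<Rightarrow> nat \<Rightarrow> nat \<Rightarrow> 'a" where
  "zero_vec R n = (\<lambda>j\<in>{1..n}. \<zero>\<^bsub>R\<^esub>)"

definition scale_vec :: "('a, 'm) ring_scheme \<Rightarrow> nat \<Rightarrow> 'a \<Rightarrow> (nat \<Rightarrow> 'a) \<Rightarrow> nat \<Rightarrow> 'a" where
  "scale_vec R n r v = (\<lambda>j\<in>{1..n}. r \<otimes>\<^bsub>R\<^esub> v j)"

definition multi_affine :: "('a, 'm) ring_scheme \<Rightarrow> nat \<Rightarrow> ((nat \<Rightarrow> 'a) \<Rightarrow> 'a) \<Rightarrow> bool" where
  "multi_affine R n f \<longleftrightarrow>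
     (\<exists>a \<in> Pow {1..n} \<rightarrow> carrier R. \<forall>x \<in> vecs R n.
        f x = (\<Oplus>\<^bsub>R\<^esub>J \<in> Pow {1..n}. a J \<otimes>\<^bsub>R\<^esub> (\<Otimes>\<^bsub>R\<^esub>j \<in> J. x j)))"

definition affine_linear_on_line ::
    "('a, 'm) ring_scheme \<Rightarrow> nat \<Rightarrow> ((nat \<Rightarrow> 'a) \<Rightarrow> 'a) \<Rightarrow> (nat \<Rightarrow> 'a) \<Rightarrow> bool" where
  "affine_linear_on_line R n f v \<longleftrightarrow>
     (\<exists>m \<in> carrier R. \<forall>r \<in> carrier R.
        f (scale_vec R n r v) = f (zero_vec R n) \<oplus>\<^bsub>R\<^esub> r \<otimes>\<^bsub>R\<^esub> m)"

definition affine_linear :: "('a, 'm) ring_scheme \<Rightarrow> nat \<Rightarrow> ((nat \<Rightarrow> 'a) \<Rightarrow> 'a) \<Rightarrow> bool" where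
  "affine_linear R n f \<longleftrightarrow>
     (\<exists>a \<in> {1..n} \<rightarrow> carrier R. \<forall>c \<in> vecs R n.
        f c = f (zero_vec R n) \<oplus>\<^bsub>R\<^esub> (\<Oplus>\<^bsub>R\<^esub>i \<in> {1..n}. a i \<otimes>\<^bsub>R\<^esub> c i))"

lemma (in cring) affine_linear_on_line_iff:
  assumes "multi_affine R n f" "v \<in> vecs R n"
  shows "affine_linear_on_line R n f v \<longleftrightarrow>
    (\<forall>r \<in> carrier R. f (scale_vec R n r v) = f (zero_vec R n) \<oplus> r \<otimes> (f v \<ominus> f (zero_vec R n)))"
proof -
  obtain a where a: "a \<in> Pow {1..n} \<rightarrow> carrier R"
    and fa: "\<And>x. x \<in> vecs R n \<Longrightarrow> f x = (\<Oplus>J \<in> Pow {1..n}. a J \<otimes> (\<Otimes>j \<in> J. x j))"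
    using assms(1) unfolding multi_affine_def by blast
  have fc: "f x \<in> carrier R" if x: "x \<in> vecs R n" for x
  proof -
    have "(\<lambda>J. a J \<otimes> (\<Otimes>j \<in> J. x j)) \<in> Pow {1..n} \<rightarrow> carrier R"
    proof
      fix J assume J: "J \<in> Pow {1..n}"
      have "x \<in> J \<rightarrow> carrier R" using J x unfolding vecs_def by auto
      then have "(\<Otimes>j \<in> J. x j) \<in> carrier R" by (rule finprod_closed)
      then show "a J \<otimes> (\<Otimes>j \<in> J. x j) \<in> carrier R" using a J by auto
    qed
    then show ?thesis using fa[OF x] by simp
  qed
  have z: "f (zero_vec R n) \<in> carrier R"
    by (rule fc) (auto simp: vecs_def zero_vec_def)
  have v: "f v \<in> carrier R" using fc assms(2) .
  have one: "scale_vec R n \<one> v = v"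
    using assms(2) unfolding vecs_def scale_vec_def
    by (intro ext) (auto simp: restrict_def PiE_iff extensional_def)
  have m: "m = f v \<ominus> f (zero_vec R n)"
    if "m \<in> carrier R" "\<forall>r \<in> carrier R. f (scale_vec R n r v) = f (zero_vec R n) \<oplus> r \<otimes> m" for m
  proof -
    have "f v = f (zero_vec R n) \<oplus> m" using bspec[OF that(2) one_closed] that(1) one by simp
    then show ?thesis using that(1) z v by (simp add: minus_eq a_ac r_neg)
  qed
  show ?thesis
  proof
    assume "affine_linear_on_line R n f v"
    then obtain k where k: "k \<in> carrier R"
      "\<forall>r \<in> carrier R. f (scale_vec R n r v) = f (zero_vec R n) \<oplus> r \<otimes> k"
      unfolding affine_linear_on_line_def by (elim bexE)
    with m[OF k] show "\<forall>r \<in> carrier R. f (scale_vec R n r v) =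
        f (zero_vec R n) \<oplus> r \<otimes> (f v \<ominus> f (zero_vec R n))" by (simp only:)
  next
    assume "\<forall>r \<in> carrier R. f (scale_vec R n r v) =
        f (zero_vec R n) \<oplus> r \<otimes> (f v \<ominus> f (zero_vec R n))"
    then show "affine_linear_on_line R n f v"
      unfolding affine_linear_on_line_def by (rule bexI) (rule minus_closed[OF v z])
  qed
qed


section \<open>Ballot directions\<close>

text \<open>The list indices start at \<open>0\<close>, so \<open>x\<^sub>i \<ge> 2i\<close> becomes \<open>2 * (i + 1) \<le> xs ! i\<close>.\<close>

definition ballot_set :: "nat \<Rightarrow> nat set \<Rightarrow> bool" where
  "ballot_set n B \<longleftrightarrow> B \<subseteq> {1..n} \<and> (\<forall>i < card B. 2 * (i + 1) \<le> sorted_list_of_set B ! i)"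

definition ballot_direction :: "('a, 'm) ring_scheme \<Rightarrow> nat \<Rightarrow> nat set \<Rightarrow> nat \<Rightarrow> 'a" where
  "ballot_direction R n B = (\<lambda>j\<in>{1..n}. if j \<in> B then \<zero>\<^bsub>R\<^esub> else \<one>\<^bsub>R\<^esub>)"

definition ballot_directions :: "('a, 'm) ring_scheme \<Rightarrow> nat \<Rightarrow> (nat \<Rightarrow> 'a) set" where
  "ballot_directions R n = ballot_direction R n ` {B. ballot_set n B}"


section \<open>Vandermonde fullness\<close>

definition annihilator :: "('a, 'm) ring_scheme \<Rightarrow> 'a set \<Rightarrow> 'a set" where
  "annihilator R J = {a \<in> carrier R. \<forall>x \<in> J. a \<otimes>\<^bsub>R\<^esub> x = \<zero>\<^bsub>R\<^esub>}"

text \<open>Only the values of the polynomial \<open>p\<^sub>n\<close> at points of \<open>R\<^sup>n\<close> are needed.\<close>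

definition vandermonde_value :: "('a, 'm) ring_scheme \<Rightarrow> nat \<Rightarrow> (nat \<Rightarrow> 'a) \<Rightarrow> 'a" where
  "vandermonde_value R n x =
     (\<Otimes>\<^bsub>R\<^esub>j \<in> {1..n}. x j) \<otimes>\<^bsub>R\<^esub>
     (\<Otimes>\<^bsub>R\<^esub>p \<in> {(j, k). 1 \<le> j \<and> j < k \<and> k \<le> n}. x (fst p) \<ominus>\<^bsub>R\<^esub> x (snd p))"

definition vandermonde_ideal :: "('a, 'm) ring_scheme \<Rightarrow> nat \<Rightarrow> 'a set" where
  "vandermonde_ideal R n = Idl\<^bsub>R\<^esub> (vandermonde_value R n ` vecs R n)"

definition vandermonde_full :: "('a, 'm) ring_scheme \<Rightarrow> nat \<Rightarrow> bool" where
  "vandermonde_full R n \<longleftrightarrow> annihilator R (vandermonde_ideal R n) = {\<zero>\<^bsub>R\<^esub>}"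


section \<open>Rings of fractions\<close>

definition loc_rel :: "('a, 'm) ring_scheme \<Rightarrow> 'a set \<Rightarrow> (('a \<times> 'a) \<times> ('a \<times> 'a)) set" where
  "loc_rel R S = {((a, s), (b, t)). a \<in> carrier R \<and> b \<in> carrier R \<and> s \<in> S \<and> t \<in> S \<and>
     (\<exists>u \<in> S. u \<otimes>\<^bsub>R\<^esub> (a \<otimes>\<^bsub>R\<^esub> t \<ominus>\<^bsub>R\<^esub> b \<otimes>\<^bsub>R\<^esub> s) = \<zero>\<^bsub>R\<^esub>)}"

definition fraction :: "('a, 'm) ring_scheme \<Rightarrow> 'a set \<Rightarrow> 'a \<Rightarrow> 'a \<Rightarrow> ('a \<times> 'a) set" where
  "fraction R S a s = loc_rel R S `` {(a, s)}"

definition localization :: "('a, 'm) ring_scheme \<Rightarrow> 'a set \<Rightarrow> ('a \<times> 'a) set ring" where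
  "localization R S =
    \<lparr>carrier = (carrier R \<times> S) // loc_rel R S,
     monoid.mult = (\<lambda>X Y. \<Union>(a, s)\<in>X. \<Union>(b, t)\<in>Y. fraction R S (a \<otimes>\<^bsub>R\<^esub> b) (s \<otimes>\<^bsub>R\<^esub> t)),
     one = fraction R S \<one>\<^bsub>R\<^esub> \<one>\<^bsub>R\<^esub>,
     zero = fraction R S \<zero>\<^bsub>R\<^esub> \<one>\<^bsub>R\<^esub>,
     add = (\<lambda>X Y. \<Union>(a, s)\<in>X. \<Union>(b, t)\<in>Y.
       fraction R S (a \<otimes>\<^bsub>R\<^esub> t \<oplus>\<^bsub>R\<^esub> b \<otimes>\<^bsub>R\<^esub> s) (s \<otimes>\<^bsub>R\<^esub> t))\<rparr>"

context cring
begin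

lemma equiv_loc_rel:
  assumes S: "S \<subseteq> carrier R" "\<one> \<in> S" "\<And>s t. s \<in> S \<Longrightarrow> t \<in> S \<Longrightarrow> s \<otimes> t \<in> S"
  shows "equiv (carrier R \<times> S) (loc_rel R S)"
proof (rule equivI)
  show "loc_rel R S \<subseteq> (carrier R \<times> S) \<times> (carrier R \<times> S)"
    unfolding loc_rel_def by auto
  have "\<one> \<otimes> (a \<otimes> s \<ominus> a \<otimes> s) = \<zero>" if "a \<in> carrier R" "s \<in> S" for a s
    using that S(1) by (simp add: minus_eq r_neg subset_iff)
  then show "refl_on (carrier R \<times> S) (loc_rel R S)"
    unfolding loc_rel_def refl_on_def using S(2) by auto
  show "sym (loc_rel R S)"
  proof (rule symI, clarify)
    fix a s b t assume "((a, s), (b, t)) \<in> loc_rel R S"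
    then obtain u where u: "a \<in> carrier R" "b \<in> carrier R" "s \<in> S" "t \<in> S" "u \<in> S"
      "u \<otimes> (a \<otimes> t \<ominus> b \<otimes> s) = \<zero>" unfolding loc_rel_def by blast
    have "s \<in> carrier R" "t \<in> carrier R" "u \<in> carrier R" using u S(1) by auto
    then have "u \<otimes> (b \<otimes> s \<ominus> a \<otimes> t) = \<ominus> (u \<otimes> (a \<otimes> t \<ominus> b \<otimes> s))" using u(1,2) by algebra
    then have "u \<otimes> (b \<otimes> s \<ominus> a \<otimes> t) = \<zero>" using u by simp
    then show "((b, t), (a, s)) \<in> loc_rel R S" unfolding loc_rel_def using u by blast
  qed
  show "trans (loc_rel R S)"
  proof (rule transI, clarify)
    fix a s b t c w
    assume "((a, s), (b, t)) \<in> loc_rel R S" "((b, t), (c, w)) \<in> loc_rel R S"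
    then obtain u v where u: "a \<in> carrier R" "b \<in> carrier R" "c \<in> carrier R"
      "s \<in> S" "t \<in> S" "w \<in> S" "u \<in> S" "v \<in> S"
      "u \<otimes> (a \<otimes> t \<ominus> b \<otimes> s) = \<zero>" "v \<otimes> (b \<otimes> w \<ominus> c \<otimes> t) = \<zero>"
      unfolding loc_rel_def by blast
    have c: "s \<in> carrier R" "t \<in> carrier R" "w \<in> carrier R" "u \<in> carrier R" "v \<in> carrier R"
      using u S(1) by auto
    have "(u \<otimes> v \<otimes> t) \<otimes> (a \<otimes> w \<ominus> c \<otimes> s) =
      v \<otimes> w \<otimes> (u \<otimes> (a \<otimes> t \<ominus> b \<otimes> s)) \<oplus> u \<otimes> s \<otimes> (v \<otimes> (b \<otimes> w \<ominus> c \<otimes> t))"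
      using c u(1,2,3) by algebra
    then have "(u \<otimes> v \<otimes> t) \<otimes> (a \<otimes> w \<ominus> c \<otimes> s) = \<zero>" using u c by simp
    then show "((a, s), (c, w)) \<in> loc_rel R S" unfolding loc_rel_def using u S(3) by blast
  qed
qed

lemma localization_ops:
  assumes S: "S \<subseteq> carrier R" "\<one> \<in> S" "\<And>s t. s \<in> S \<Longrightarrow> t \<in> S \<Longrightarrow> s \<otimes> t \<in> S"
    and a: "a \<in> carrier R" "b \<in> carrier R" "s \<in> S" "t \<in> S"
  shows "fraction R S a s \<otimes>\<^bsub>localization R S\<^esub> fraction R S b t = fraction R S (a \<otimes> b) (s \<otimes> t)"
    and "fraction R S a s \<oplus>\<^bsub>localization R S\<^esub> fraction R S b t =
      fraction R S (a \<otimes> t \<oplus> b \<otimes> s) (s \<otimes> t)"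
proof -
  have E: "equiv (carrier R \<times> S) (loc_rel R S)" using S by (rule equiv_loc_rel)
  have mult: "fraction R S (c \<otimes> d) (w \<otimes> z) = fraction R S (a \<otimes> b) (s \<otimes> t)"
    and add: "fraction R S (c \<otimes> z \<oplus> d \<otimes> w) (w \<otimes> z) = fraction R S (a \<otimes> t \<oplus> b \<otimes> s) (s \<otimes> t)"
    if cd: "(c, w) \<in> fraction R S a s" "(d, z) \<in> fraction R S b t" for c w d z
  proof -
    obtain u v where u: "c \<in> carrier R" "d \<in> carrier R" "w \<in> S" "z \<in> S" "u \<in> S" "v \<in> S"
      "u \<otimes> (a \<otimes> w \<ominus> c \<otimes> s) = \<zero>" "v \<otimes> (b \<otimes> z \<ominus> d \<otimes> t) = \<zero>"
      using cd unfolding fraction_def loc_rel_def by blast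
    have cl: "s \<in> carrier R" "t \<in> carrier R" "w \<in> carrier R" "z \<in> carrier R"
      "u \<in> carrier R" "v \<in> carrier R" using u a S(1) by auto
    have "(u \<otimes> v) \<otimes> ((a \<otimes> b) \<otimes> (w \<otimes> z) \<ominus> (c \<otimes> d) \<otimes> (s \<otimes> t)) =
      v \<otimes> b \<otimes> z \<otimes> (u \<otimes> (a \<otimes> w \<ominus> c \<otimes> s)) \<oplus> u \<otimes> c \<otimes> s \<otimes> (v \<otimes> (b \<otimes> z \<ominus> d \<otimes> t))"
      using cl u(1,2) a(1,2) by algebra
    then have "(u \<otimes> v) \<otimes> ((a \<otimes> b) \<otimes> (w \<otimes> z) \<ominus> (c \<otimes> d) \<otimes> (s \<otimes> t)) = \<zero>"
      using u cl a by simp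
    then have "((a \<otimes> b, s \<otimes> t), (c \<otimes> d, w \<otimes> z)) \<in> loc_rel R S"
      unfolding loc_rel_def using u a S(3) by blast
    then show "fraction R S (c \<otimes> d) (w \<otimes> z) = fraction R S (a \<otimes> b) (s \<otimes> t)"
      unfolding fraction_def using equiv_class_eq[OF E] by metis
    have "(u \<otimes> v) \<otimes> ((a \<otimes> t \<oplus> b \<otimes> s) \<otimes> (w \<otimes> z) \<ominus> (c \<otimes> z \<oplus> d \<otimes> w) \<otimes> (s \<otimes> t)) =
      v \<otimes> t \<otimes> z \<otimes> (u \<otimes> (a \<otimes> w \<ominus> c \<otimes> s)) \<oplus> u \<otimes> s \<otimes> w \<otimes> (v \<otimes> (b \<otimes> z \<ominus> d \<otimes> t))"
      using cl u(1,2) a(1,2) by algebra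
    then have "(u \<otimes> v) \<otimes> ((a \<otimes> t \<oplus> b \<otimes> s) \<otimes> (w \<otimes> z) \<ominus> (c \<otimes> z \<oplus> d \<otimes> w) \<otimes> (s \<otimes> t)) = \<zero>"
      using u cl a by simp
    moreover have "a \<otimes> t \<oplus> b \<otimes> s \<in> carrier R" "c \<otimes> z \<oplus> d \<otimes> w \<in> carrier R"
      using a u cl by auto
    ultimately have "((a \<otimes> t \<oplus> b \<otimes> s, s \<otimes> t), (c \<otimes> z \<oplus> d \<otimes> w, w \<otimes> z)) \<in> loc_rel R S"
      unfolding loc_rel_def using u a S(3) by blast
    then show "fraction R S (c \<otimes> z \<oplus> d \<otimes> w) (w \<otimes> z) = fraction R S (a \<otimes> t \<oplus> b \<otimes> s) (s \<otimes> t)"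
      unfolding fraction_def using equiv_class_eq[OF E] by metis
  qed
  have ne: "(a, s) \<in> fraction R S a s" "(b, t) \<in> fraction R S b t"
    unfolding fraction_def using equiv_class_self[OF E] a by auto
  have UN: "(\<Union>(c, w)\<in>fraction R S a s. \<Union>(d, z)\<in>fraction R S b t. F c w d z) = K"
    if F: "\<And>c w d z. (c, w) \<in> fraction R S a s \<Longrightarrow> (d, z) \<in> fraction R S b t \<Longrightarrow> F c w d z = K"
    for F :: "'a \<Rightarrow> 'a \<Rightarrow> 'a \<Rightarrow> 'a \<Rightarrow> ('a \<times> 'a) set" and K
  proof -
    have "(\<Union>(c, w)\<in>fraction R S a s. \<Union>(d, z)\<in>fraction R S b t. F c w d z) =
      (\<Union>p\<in>fraction R S a s. \<Union>q\<in>fraction R S b t. K)"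
      by (intro SUP_cong refl) (auto simp: F)
    also have "\<dots> = K" using ne by (simp only: UN_constant) auto
    finally show ?thesis .
  qed
  have "fraction R S a s \<otimes>\<^bsub>localization R S\<^esub> fraction R S b t =
      (\<Union>(c, w)\<in>fraction R S a s. \<Union>(d, z)\<in>fraction R S b t.
         fraction R S (c \<otimes> d) (w \<otimes> z))"
    by (simp only: localization_def monoid.simps)
  also have "\<dots> = fraction R S (a \<otimes> b) (s \<otimes> t)" by (rule UN) (rule mult)
  finally show "fraction R S a s \<otimes>\<^bsub>localization R S\<^esub> fraction R S b t =
      fraction R S (a \<otimes> b) (s \<otimes> t)" .
  have "fraction R S a s \<oplus>\<^bsub>localization R S\<^esub> fraction R S b t =
      (\<Union>(c, w)\<in>fraction R S a s. \<Union>(d, z)\<in>fraction R S b t.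
         fraction R S (c \<otimes> z \<oplus> d \<otimes> w) (w \<otimes> z))"
    by (simp only: localization_def ring.simps)
  also have "\<dots> = fraction R S (a \<otimes> t \<oplus> b \<otimes> s) (s \<otimes> t)" by (rule UN) (rule add)
  finally show "fraction R S a s \<oplus>\<^bsub>localization R S\<^esub> fraction R S b t =
      fraction R S (a \<otimes> t \<oplus> b \<otimes> s) (s \<otimes> t)" .
qed

lemma localization_cring:
  assumes S: "S \<subseteq> carrier R" "\<one> \<in> S" "\<And>s t. s \<in> S \<Longrightarrow> t \<in> S \<Longrightarrow> s \<otimes> t \<in> S"
  shows "cring (localization R S)"
proof -
  let ?L = "localization R S"
  note E = equiv_loc_rel[OF S]
  note ops = localization_ops[OF S]
  have carr: "carrier ?L = {fraction R S a s | a s. a \<in> carrier R \<and> s \<in> S}"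
    unfolding localization_def fraction_def quotient_def by auto
  have one: "\<one>\<^bsub>?L\<^esub> = fraction R S \<one> \<one>" and zero: "\<zero>\<^bsub>?L\<^esub> = fraction R S \<zero> \<one>"
    by (simp_all add: localization_def)
  have Sc: "s \<in> carrier R" if "s \<in> S" for s using that S(1) by blast
  have eq: "fraction R S a s = fraction R S b t"
    if "a \<in> carrier R" "b \<in> carrier R" "s \<in> S" "t \<in> S" "a \<otimes> t = b \<otimes> s" for a b s t
  proof -
    have "\<one> \<otimes> (a \<otimes> t \<ominus> b \<otimes> s) = \<zero>" using that Sc by (simp add: minus_eq r_neg)
    then have "((a, s), (b, t)) \<in> loc_rel R S" unfolding loc_rel_def using that S(2) by blast
    then show ?thesis unfolding fraction_def using equiv_class_eq[OF E] by metis
  qed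
  have cases: "\<exists>a s. a \<in> carrier R \<and> s \<in> S \<and> X = fraction R S a s" if "X \<in> carrier ?L" for X
    using that unfolding carr by blast
  have cl: "fraction R S a s \<in> carrier ?L" if "a \<in> carrier R" "s \<in> S" for a s
    using that unfolding carr by blast
  have grp: "abelian_group ?L"
  proof (rule abelian_groupI)
    fix X Y assume "X \<in> carrier ?L" "Y \<in> carrier ?L"
    then obtain a s b t where x: "a \<in> carrier R" "s \<in> S" "X = fraction R S a s"
      "b \<in> carrier R" "t \<in> S" "Y = fraction R S b t" using cases by meson
    show "X \<oplus>\<^bsub>?L\<^esub> Y \<in> carrier ?L"
      using x Sc S(3) by (auto simp: ops intro!: cl)
    show "X \<oplus>\<^bsub>?L\<^esub> Y = Y \<oplus>\<^bsub>?L\<^esub> X"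
      using x Sc by (simp add: ops m_comm a_comm)
  next
    show "\<zero>\<^bsub>?L\<^esub> \<in> carrier ?L" unfolding zero using S(2) by (auto intro!: cl)
  next
    fix X Y Z assume "X \<in> carrier ?L" "Y \<in> carrier ?L" "Z \<in> carrier ?L"
    then obtain a s b t c w where x: "a \<in> carrier R" "s \<in> S" "X = fraction R S a s"
      "b \<in> carrier R" "t \<in> S" "Y = fraction R S b t"
      "c \<in> carrier R" "w \<in> S" "Z = fraction R S c w" using cases by meson
    show "X \<oplus>\<^bsub>?L\<^esub> Y \<oplus>\<^bsub>?L\<^esub> Z = X \<oplus>\<^bsub>?L\<^esub> (Y \<oplus>\<^bsub>?L\<^esub> Z)"
    proof -
      have c: "s \<in> carrier R" "t \<in> carrier R" "w \<in> carrier R" using x Sc by auto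
      have "(a \<otimes> t \<oplus> b \<otimes> s) \<otimes> w \<oplus> c \<otimes> (s \<otimes> t) = a \<otimes> (t \<otimes> w) \<oplus> (b \<otimes> w \<oplus> c \<otimes> t) \<otimes> s"
        using x(1,4,7) c by algebra
      moreover have "s \<otimes> t \<otimes> w = s \<otimes> (t \<otimes> w)" using c by (rule m_assoc)
      ultimately show ?thesis using x c S(3) by (simp add: ops)
    qed
  next
    fix X assume "X \<in> carrier ?L"
    then obtain a s where x: "a \<in> carrier R" "s \<in> S" "X = fraction R S a s" using cases by meson
    show "\<zero>\<^bsub>?L\<^esub> \<oplus>\<^bsub>?L\<^esub> X = X"
      using x Sc S(2) by (simp add: ops zero)
    have "fraction R S (\<ominus> a) s \<oplus>\<^bsub>?L\<^esub> X = fraction R S (\<ominus> a \<otimes> s \<oplus> a \<otimes> s) (s \<otimes> s)"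
      using x by (simp add: ops)
    also have "\<ominus> a \<otimes> s \<oplus> a \<otimes> s = \<zero>" using x(1) Sc[OF x(2)] by (simp add: l_minus l_neg)
    also have "fraction R S \<zero> (s \<otimes> s) = fraction R S \<zero> \<one>"
      by (rule eq) (use x S(2,3) Sc in auto)
    finally show "\<exists>Y\<in>carrier ?L. Y \<oplus>\<^bsub>?L\<^esub> X = \<zero>\<^bsub>?L\<^esub>"
      unfolding zero using cl[of "\<ominus> a" s] x by auto
  qed
  have mon: "comm_monoid ?L"
  proof (rule comm_monoidI)
    show "\<one>\<^bsub>?L\<^esub> \<in> carrier ?L" unfolding one using S(2) by (auto intro!: cl)
    fix X assume X: "X \<in> carrier ?L"
    then obtain a s where x: "a \<in> carrier R" "s \<in> S" "X = fraction R S a s" using cases by meson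
    show "\<one>\<^bsub>?L\<^esub> \<otimes>\<^bsub>?L\<^esub> X = X"
      using x Sc S(2) by (simp add: ops one)
    fix Y assume "Y \<in> carrier ?L"
    then obtain b t where y: "b \<in> carrier R" "t \<in> S" "Y = fraction R S b t" using cases by meson
    show "X \<otimes>\<^bsub>?L\<^esub> Y \<in> carrier ?L"
      using x y S(3) by (auto simp: ops intro!: cl)
    show "X \<otimes>\<^bsub>?L\<^esub> Y = Y \<otimes>\<^bsub>?L\<^esub> X"
      using x y Sc by (simp add: ops m_comm)
    fix Z assume "Z \<in> carrier ?L"
    then obtain c w where z: "c \<in> carrier R" "w \<in> S" "Z = fraction R S c w" using cases by meson
    show "X \<otimes>\<^bsub>?L\<^esub> Y \<otimes>\<^bsub>?L\<^esub> Z = X \<otimes>\<^bsub>?L\<^esub> (Y \<otimes>\<^bsub>?L\<^esub> Z)"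
      using x y z Sc S(3) by (simp add: ops m_assoc)
  qed
  show ?thesis
  proof (rule cringI[OF grp mon])
    fix X Y Z assume "X \<in> carrier ?L" "Y \<in> carrier ?L" "Z \<in> carrier ?L"
    then obtain a s b t c w where x: "a \<in> carrier R" "s \<in> S" "X = fraction R S a s"
      "b \<in> carrier R" "t \<in> S" "Y = fraction R S b t"
      "c \<in> carrier R" "w \<in> S" "Z = fraction R S c w" using cases by meson
    show "(X \<oplus>\<^bsub>?L\<^esub> Y) \<otimes>\<^bsub>?L\<^esub> Z = X \<otimes>\<^bsub>?L\<^esub> Z \<oplus>\<^bsub>?L\<^esub> Y \<otimes>\<^bsub>?L\<^esub> Z"
    proof -
      have c: "s \<in> carrier R" "t \<in> carrier R" "w \<in> carrier R" using x Sc by auto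
      have m: "s \<otimes> t \<otimes> w \<in> S" "s \<otimes> w \<otimes> (t \<otimes> w) \<in> S" using x S(3) by auto
      have "((a \<otimes> t \<oplus> b \<otimes> s) \<otimes> c) \<otimes> (s \<otimes> w \<otimes> (t \<otimes> w)) =
          (a \<otimes> c \<otimes> (t \<otimes> w) \<oplus> b \<otimes> c \<otimes> (s \<otimes> w)) \<otimes> (s \<otimes> t \<otimes> w)"
        using x(1,4,7) c by algebra
      then have "fraction R S ((a \<otimes> t \<oplus> b \<otimes> s) \<otimes> c) (s \<otimes> t \<otimes> w) =
          fraction R S (a \<otimes> c \<otimes> (t \<otimes> w) \<oplus> b \<otimes> c \<otimes> (s \<otimes> w)) (s \<otimes> w \<otimes> (t \<otimes> w))"
        using x(1,4,7) c m by (intro eq) auto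
      then show ?thesis using x c S(3) by (simp add: ops)
    qed
  qed
qed

end

text \<open>In a nonzero ring \<open>0\<close> is a zerodivisor in the following sense.  The zero ring has no
  zerodivisors, so that its total ring of fractions is again the zero ring.\<close>

definition zerodivisors :: "('a, 'm) ring_scheme \<Rightarrow> 'a set" where
  "zerodivisors R = {a \<in> carrier R. \<exists>b \<in> carrier R. b \<noteq> \<zero>\<^bsub>R\<^esub> \<and> a \<otimes>\<^bsub>R\<^esub> b = \<zero>\<^bsub>R\<^esub>}"

definition total_fractions :: "('a, 'm) ring_scheme \<Rightarrow> ('a \<times> 'a) set ring" where
  "total_fractions R = localization R (carrier R - zerodivisors R)"

lemma (in cring) total_fractions_cring: "cring (total_fractions R)"
  unfolding total_fractions_def
proof (rule localization_cring)
  show "\<one> \<in> carrier R - zerodivisors R" unfolding zerodivisors_def by auto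
  fix s t assume s: "s \<in> carrier R - zerodivisors R" and t: "t \<in> carrier R - zerodivisors R"
  have "b = \<zero>" if b: "b \<in> carrier R" "s \<otimes> t \<otimes> b = \<zero>" for b
  proof -
    have "s \<otimes> (t \<otimes> b) = \<zero>" using b s t by (simp add: m_assoc)
    then have "t \<otimes> b = \<zero>" using b s t unfolding zerodivisors_def by auto
    then show ?thesis using b t unfolding zerodivisors_def by auto
  qed
  then show "s \<otimes> t \<in> carrier R - zerodivisors R"
    using s t unfolding zerodivisors_def by auto
qed auto


section \<open>Products of rings whose total ring of fractions is Kasch\<close>

definition kasch :: "('a, 'm) ring_scheme \<Rightarrow> bool" where
  "kasch R \<longleftrightarrow> cring R \<and> (\<forall>M. maximalideal M R \<longrightarrow> annihilator R M \<noteq> {\<zero>\<^bsub>R\<^esub>})"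

definition product_ring :: "'i set \<Rightarrow> ('i \<Rightarrow> ('b, 'm) ring_scheme) \<Rightarrow> ('i \<Rightarrow> 'b) ring" where
  "product_ring I S =
    \<lparr>carrier = (\<Pi>\<^sub>E i\<in>I. carrier (S i)),
     monoid.mult = (\<lambda>x y. \<lambda>i\<in>I. x i \<otimes>\<^bsub>S i\<^esub> y i),
     one = (\<lambda>i\<in>I. \<one>\<^bsub>S i\<^esub>),
     zero = (\<lambda>i\<in>I. \<zero>\<^bsub>S i\<^esub>),
     add = (\<lambda>x y. \<lambda>i\<in>I. x i \<oplus>\<^bsub>S i\<^esub> y i)\<rparr>"

text \<open>Membership in the class of these products, up to ring isomorphism.  The type arguments are the
  types of the indices and of the elements of the factors.  A theorem in which they are type
  variables covers every family of rings, because all carriers of a family embed into one type.\<close>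

definition product_of_Q_kasch ::
    "'i itself \<Rightarrow> 'b itself \<Rightarrow> ('a, 'm) ring_scheme \<Rightarrow> bool" where
  "product_of_Q_kasch _ _ R \<longleftrightarrow>
     (\<exists>(I :: 'i set) (S :: 'i \<Rightarrow> 'b ring).
        I \<noteq> {} \<and> (\<forall>i\<in>I. cring (S i) \<and> kasch (total_fractions (S i))) \<and> R \<simeq> product_ring I S)"

end

theory Submission
  imports Defs "HOL-Algebra.Ring_Divisibility"
begin

text \<open>
  Split a multi-affine map \<open>f\<close> into its homogeneous parts \<open>f\<^sub>k\<close>, so that
  \<open>f(r v) = \<Sum>\<^sub>k r\<^sup>k f\<^sub>k(v)\<close>.  If \<open>f\<close> is affine-linear on the line \<open>R v\<close> with slope \<open>m\<close>, then the polynomial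
  \<open>r (f\<^sub>1(v) - m) + \<Sum>\<^sub>k\<^sub>\<ge>\<^sub>2 r\<^sup>k f\<^sub>k(v)\<close> vanishes at every \<open>r\<close>.  Comparing its values at \<open>n\<close> points shows
  that each value of \<open>p\<^sub>n\<close> annihilates its coefficients
  (\<open>vandermonde_value_annihilates_coeffs\<close>), hence \<open>f\<^sub>k(v) = 0\<close> for \<open>k \<ge> 2\<close> when the ring is
  Vandermonde full.  In the ballot direction of \<open>B\<close>, the value \<open>f\<^sub>k(v)\<close> is the sum of the coefficients
  \<open>a\<^sub>J\<close> over the \<open>k\<close>-sets \<open>J\<close> disjoint from \<open>B\<close>, and over every abelian group these sums determine the
  family \<open>a\<close> on \<open>k\<close>-sets (\<open>zero_if_ballot_disjoint_sums_zero\<close>).  So all coefficients of degree at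
  least \<open>2\<close> vanish.

  Fewer than \<open>N\<close> directions cannot suffice: for \<open>k = n - \<lfloor>n/2\<rfloor>\<close>, which is at least \<open>2\<close>, a homogeneous map
  of degree \<open>k\<close> has \<open>N\<close> coefficients, and to vanish at \<open>m < N\<close> given vectors is a system of \<open>m\<close> linear
  equations in them.  Such a system has a nonzero solution over every nonzero commutative ring
  (\<open>underdetermined_system\<close>).

  If the ring is not Vandermonde full, then some \<open>a \<noteq> 0\<close> annihilates all values of \<open>p\<^sub>n\<close>, and this
  passes to a factor \<open>R\<^sub>i\<close> of the product.  The annihilator of \<open>a\<close> consists of zerodivisors, so it lies
  in a maximal ideal \<open>M\<close> of \<open>Q(R\<^sub>i)\<close>, and \<open>M\<close> is annihilated by a nonzero fraction \<open>b/s\<close>.  Since \<open>p\<^sub>n\<close>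
  vanishes on the image of \<open>R\<^sub>i\<close> in the field \<open>Q(R\<^sub>i)/M\<close>, this image has at most \<open>n\<close> elements; calling
  their number \<open>k\<close>, it satisfies \<open>r\<^sup>k = r\<close>, whence \<open>b r\<^sup>k = b r\<close> in \<open>R\<^sub>i\<close>
  (\<open>Q_kasch_powers_agree\<close>).  Then \<open>b x\<^sub>1 \<cdots> x\<^sub>k\<close> is affine-linear on every line through the origin,
  but \<open>k \<ge> 2\<close>.
\<close>

section \<open>Ballot sets\<close>

text \<open>The \<open>i\<close>-th smallest element \<open>x\<close> is the one with \<open>i\<close> elements of the set up to and including \<open>x\<close>.  Stated
through initial segments, the ballot condition no longer refers to positions in a list, and it is clear
what the insertion of a new largest element does to it.\<close>

lemma ballot_set_iff:
  "ballot_set n B \<longleftrightarrow> B \<subseteq> {1..n} \<and> (\<forall>x\<in>B. 2 * card {y\<in>B. y \<le> x} \<le> x)"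
proof (cases "B \<subseteq> {1..n}")
  case True
  then have fin: "finite B" by (rule finite_subset) simp
  define xs where "xs = sorted_list_of_set B"
  have xs: "set xs = B" "length xs = card B" "sorted xs" "distinct xs"
    using fin by (simp_all add: xs_def)
  have initial: "card {y\<in>B. y \<le> xs ! i} = i + 1" if i: "i < card B" for i
  proof -
    have le: "j \<le> i \<longleftrightarrow> xs ! j \<le> xs ! i" if "j < card B" for j
      using that i xs by (metis le_eq_less_or_eq linorder_not_le nth_eq_iff_index_eq sorted_nth_mono)
    have "{y\<in>B. y \<le> xs ! i} = (!) xs ` {..i}"
    proof (intro Set.set_eqI iffI)
      fix y assume "y \<in> {y\<in>B. y \<le> xs ! i}"
      then obtain j where "j < card B" "y = xs ! j" "xs ! j \<le> xs ! i"
        using xs by (metis (mono_tags, lifting) in_set_conv_nth mem_Collect_eq)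
      then show "y \<in> (!) xs ` {..i}" using le by auto
    next
      fix y assume "y \<in> (!) xs ` {..i}"
      then obtain j where "j \<le> i" "y = xs ! j" by auto
      then show "y \<in> {y\<in>B. y \<le> xs ! i}" using le[of j] i xs nth_mem[of j xs] by auto
    qed
    moreover have "inj_on ((!) xs) {..i}"
      using i xs by (auto simp: inj_on_def nth_eq_iff_index_eq)
    ultimately show ?thesis by (simp add: card_image)
  qed
  have "(\<forall>i<card B. 2 * (i + 1) \<le> xs ! i) \<longleftrightarrow>
      (\<forall>i<length xs. 2 * card {y\<in>B. y \<le> xs ! i} \<le> xs ! i)"
    using initial xs(2) by simp
  also have "\<dots> \<longleftrightarrow> (\<forall>x\<in>set xs. 2 * card {y\<in>B. y \<le> x} \<le> x)"
    by (simp only: all_set_conv_all_nth)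
  finally have "(\<forall>i<card B. 2 * (i + 1) \<le> xs ! i) \<longleftrightarrow>
      (\<forall>x\<in>B. 2 * card {y\<in>B. y \<le> x} \<le> x)" unfolding xs(1) .
  then show ?thesis using True unfolding ballot_set_def xs_def by blast
qed (simp add: ballot_set_def)

lemma ballot_set_subset: "ballot_set n B \<Longrightarrow> B \<subseteq> {1..n}"
  by (simp add: ballot_set_def)

lemma ballot_set_empty: "ballot_set n {}"
  by (simp add: ballot_set_def)

lemma ballot_set_Suc:
  assumes "B \<subseteq> {1..n}"
  shows "ballot_set (Suc n) B \<longleftrightarrow> ballot_set n B"
  using assms by (fastforce simp: ballot_set_iff)

lemma ballot_set_insert_Suc:
  assumes B: "B \<subseteq> {1..n}"
  shows "ballot_set (Suc n) (insert (Suc n) B) \<longleftrightarrow> ballot_set n B \<and> 2 * Suc (card B) \<le> Suc n"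
proof -
  have fin: "finite B" using B by (rule finite_subset) simp
  have old: "{y \<in> insert (Suc n) B. y \<le> x} = {y\<in>B. y \<le> x}" if "x \<in> B" for x
    using that B by (auto dest: subsetD)
  have new: "{y \<in> insert (Suc n) B. y \<le> Suc n} = insert (Suc n) B"
    using B by (auto dest: subsetD)
  have "card (insert (Suc n) B) = Suc (card B)"
    using fin B by (subst card_insert_disjoint) auto
  moreover have "insert (Suc n) B \<subseteq> {1..Suc n}" using B by auto
  ultimately show ?thesis
    unfolding ballot_set_iff ball_simps new using B by (auto simp only: old)
qed

lemma finite_ballot_sets: "finite {B. ballot_set n B \<and> P B}"
  by (rule finite_subset[of _ "Pow {1..n}"]) (auto dest!: ballot_set_subset)

lemma card_ballot_set_le: "ballot_set n B \<Longrightarrow> card B \<le> n div 2"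
proof -
  assume B: "ballot_set n B"
  show ?thesis
  proof (cases "B = {}")
    case False
    have fin: "finite B" using B by (meson ballot_set_subset finite_atLeastAtMost finite_subset)
    have "{y\<in>B. y \<le> Max B} = B" using fin by auto
    then have "2 * card B \<le> Max B" using B False fin unfolding ballot_set_iff
      by (metis Max_in)
    moreover have "Max B \<le> n" using B False fin ballot_set_subset[OF B] by (meson Max_in atLeastAtMost_iff subset_iff)
    ultimately show ?thesis by linarith
  qed simp
qed

text \<open>Sorting by whether \<open>n + 1\<close> is a member gives Pascal's recursion.  The bound \<open>2 * j \<le> n\<close> fails for the
smaller ground set only in the middle, at \<open>n = 2 * j - 1\<close>, where no ballot set has \<open>j\<close> elements and
the symmetry of the binomial coefficients supplies the value.\<close>

lemma card_ballot_sets_card_le: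
  "2 * j \<le> n \<Longrightarrow> card {B. ballot_set n B \<and> card B \<le> j} = n choose j"
proof (induction n arbitrary: j)
  case 0
  then have "{B. ballot_set 0 B \<and> card B \<le> j} = {{}}" by (auto simp: ballot_set_def)
  then show ?case using 0 by simp
next
  case (Suc n)
  show ?case
  proof (cases j)
    case 0
    have "B = {}" if "ballot_set (Suc n) B" "card B = 0" for B
      using that by (metis ballot_set_subset card_0_eq finite_atLeastAtMost finite_subset)
    then have "{B. ballot_set (Suc n) B \<and> card B \<le> j} = {{}}"
      using 0 by (auto simp: ballot_set_empty)
    then show ?thesis using 0 by simp
  next
    case (Suc i)
    let ?A = "{B. ballot_set n B \<and> card B \<le> Suc i}"
    let ?C = "{B. ballot_set n B \<and> card B \<le> i}"
    have i: "2 * i \<le> n" "2 * Suc i \<le> Suc n" using Suc.prems Suc by auto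
    have ins: "card (insert (Suc n) B) = Suc (card B)" if "B \<subseteq> {1..n}" for B
      using that finite_subset[OF that] by (subst card_insert_disjoint) auto
    have split: "{B. ballot_set (Suc n) B \<and> card B \<le> Suc i} = ?A \<union> insert (Suc n) ` ?C"
    proof (intro Set.set_eqI iffI)
      fix B assume B: "B \<in> {B. ballot_set (Suc n) B \<and> card B \<le> Suc i}"
      show "B \<in> ?A \<union> insert (Suc n) ` ?C"
      proof (cases "Suc n \<in> B")
        case True
        have B': "B - {Suc n} \<subseteq> {1..n}" using B ballot_set_subset[of "Suc n" B] by force
        have eq: "insert (Suc n) (B - {Suc n}) = B" using True by blast
        have "B - {Suc n} \<in> ?C"
          using B ins[OF B'] ballot_set_insert_Suc[OF B'] unfolding eq by simp
        then have "insert (Suc n) (B - {Suc n}) \<in> insert (Suc n) ` ?C" by (rule imageI)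
        then show ?thesis unfolding eq by (rule UnI2)
      next
        case False
        then have "B \<subseteq> {1..n}" using B ballot_set_subset[of "Suc n" B] by (force simp: le_Suc_eq)
        then show ?thesis using B ballot_set_Suc by auto
      qed
    next
      fix B assume "B \<in> ?A \<union> insert (Suc n) ` ?C"
      then show "B \<in> {B. ballot_set (Suc n) B \<and> card B \<le> Suc i}"
      proof
        assume "B \<in> ?A"
        then show ?thesis using ballot_set_Suc ballot_set_subset by blast
      next
        assume "B \<in> insert (Suc n) ` ?C"
        then obtain B' where B': "B = insert (Suc n) B'" "ballot_set n B'" "card B' \<le> i" by blast
        note sub = ballot_set_subset[OF B'(2)]
        show ?thesis using B' ins[OF sub] ballot_set_insert_Suc[OF sub] i by simp
      qed
    qed
    have notin: "Suc n \<notin> B" if "ballot_set n B" for B using ballot_set_subset[OF that] by auto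
    have inj: "inj_on (insert (Suc n)) ?C"
      using notin by (auto simp: inj_on_def dest: insert_ident)
    have "?A \<inter> insert (Suc n) ` ?C = {}" using notin by auto
    then have "card {B. ballot_set (Suc n) B \<and> card B \<le> Suc i} = card ?A + card ?C"
      unfolding split using card_image[OF inj]
      by (subst card_Un_disjoint) (auto intro: finite_ballot_sets)
    also have "card ?C = n choose i" using Suc.IH i(1) .
    also have "card ?A = n choose Suc i"
    proof (cases "2 * Suc i \<le> n")
      case True
      then show ?thesis by (rule Suc.IH)
    next
      case False
      then have n: "n = 2 * i + 1" using i by simp
      have "?A = ?C" using card_ballot_set_le[of n] n by fastforce
      also have "card ?C = n choose i" using Suc.IH i(1) .
      also have "\<dots> = n choose Suc i" using binomial_symmetric[of i n] n by simp
      finally show ?thesis .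
    qed
    finally show ?thesis using Suc by simp
  qed
qed

lemma card_ballot_sets: "card {B. ballot_set n B} = n choose (n div 2)"
proof -
  have "{B. ballot_set n B} = {B. ballot_set n B \<and> card B \<le> n div 2}"
    using card_ballot_set_le by blast
  then show ?thesis using card_ballot_sets_card_le[of "n div 2" n] by simp
qed


section \<open>Functions on sets of fixed size\<close>

definition ksubsets :: "nat set \<Rightarrow> nat \<Rightarrow> nat set set" where
  "ksubsets X k = {J. J \<subseteq> X \<and> card J = k}"

lemma finite_ksubsets: "finite X \<Longrightarrow> finite (ksubsets X k)"
  unfolding ksubsets_def by simp

lemma card_ksubsets: "finite X \<Longrightarrow> card (ksubsets X k) = card X choose k"
  unfolding ksubsets_def by (rule n_subsets)

lemma Pow_eq_Union_ksubsets: "Pow {1..n} = (\<Union>k\<in>{..n}. ksubsets {1..n} k)"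
proof -
  have "card J \<le> n" if "J \<subseteq> {1..n}" for J
    using card_mono[OF _ that] by simp
  then show ?thesis unfolding ksubsets_def by auto
qed

lemma ksubsets_mono: "X \<subseteq> Y \<Longrightarrow> ksubsets X k \<subseteq> ksubsets Y k"
  unfolding ksubsets_def by auto

text \<open>For \<open>k \<le> n\<close>, the disjointness matrix between \<open>k\<close>-sets and ballot sets of size at most \<open>min k (n - k)\<close> is
unimodular, which is why the conclusion holds over every abelian group.  The induction splits \<open>g\<close> into
its restrictions to the \<open>k\<close>-sets that avoid or contain the largest point \<open>n\<close>.  A ballot set \<open>B\<close> of the
smaller ground set gives the sum of the two restricted sums, and \<open>B\<close> together with \<open>n\<close> gives the
first one alone; the latter needs \<open>B\<close> to be one element smaller.  The size bound is part of the
induction, because it says for which of the two restrictions the smaller sets already suffice.\<close>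

lemma (in abelian_group) zero_if_ballot_disjoint_sums_zero:
  assumes "g \<in> ksubsets {1..n} k \<rightarrow> carrier G"
    and "\<And>B. ballot_set n B \<Longrightarrow> card B \<le> min k (n - k) \<Longrightarrow>
      (\<Oplus>J\<in>ksubsets ({1..n} - B) k. g J) = \<zero>"
    and "J \<in> ksubsets {1..n} k"
  shows "g J = \<zero>"
  using assms
proof (induction n arbitrary: g k J)
  case 0
  then have "ksubsets {1..0} k = {{}}" "J = {}" "k = 0" by (auto simp: ksubsets_def)
  then show ?case using 0(1) 0(2)[OF ballot_set_empty] by (auto simp: Pi_def)
next
  case (Suc n)
  note g = Suc.prems(1) and sum0 = Suc.prems(2)
  have finJ: "finite J" using Suc.prems(3) unfolding ksubsets_def by (auto intro: finite_subset)
  show ?case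
  proof (cases k)
    case 0
    then have "ksubsets {1..Suc n} k = {{}}" "J = {}" 
      using Suc.prems(3) finJ by (auto simp: ksubsets_def card_eq_0_iff intro: finite_subset)
    then show ?thesis using g sum0[OF ballot_set_empty] by (auto simp: Pi_def)
  next
    case (Suc l)
    \<comment> \<open>\<open>k = l + 1\<close>; \<open>h\<close> is the restriction of \<open>g\<close> to the \<open>k\<close>-sets that contain the largest point.\<close>
    define h where "h J = g (insert (Suc n) J)" for J
    have ins: "card (insert (Suc n) J) = Suc (card J)" if "J \<subseteq> {1..n}" for J
      using that finite_subset[OF that] by (subst card_insert_disjoint) auto
    have g': "g \<in> ksubsets {1..n} k \<rightarrow> carrier G"
      using g ksubsets_mono[of "{1..n}" "{1..Suc n}"] by (auto simp: Pi_def)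
    have h': "h \<in> ksubsets {1..n} l \<rightarrow> carrier G"
    proof
      fix J assume "J \<in> ksubsets {1..n} l"
      then have "insert (Suc n) J \<in> ksubsets {1..Suc n} k"
        using ins[of J] Suc unfolding ksubsets_def by auto
      then show "h J \<in> carrier G" unfolding h_def using g by blast
    qed
    define Sg where "Sg B = (\<Oplus>J\<in>ksubsets ({1..n} - B) k. g J)" for B
    define Sh where "Sh B = (\<Oplus>J\<in>ksubsets ({1..n} - B) l. h J)" for B
    have gB: "g \<in> ksubsets ({1..n} - B) k \<rightarrow> carrier G" for B
      using g' ksubsets_mono[of "{1..n} - B" "{1..n}"] by (auto simp: Pi_def)
    have hB: "h \<in> ksubsets ({1..n} - B) l \<rightarrow> carrier G" for B
      using h' ksubsets_mono[of "{1..n} - B" "{1..n}"] by (auto simp: Pi_def)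
    have Sg: "Sg B \<in> carrier G" and Sh: "Sh B \<in> carrier G" for B
      unfolding Sg_def Sh_def using gB hB by simp_all
    have both: "Sg B \<oplus> Sh B = \<zero>" if B: "ballot_set n B" "card B \<le> min k (Suc n - k)" for B
    proof -
      note sub = ballot_set_subset[OF B(1)]
      have notin: "Suc n \<notin> J" if "J \<in> ksubsets ({1..n} - B) l" for J l
        using that unfolding ksubsets_def by auto
      have inj: "inj_on (insert (Suc n)) (ksubsets ({1..n} - B) l)"
      proof (rule inj_onI)
        fix I J assume "I \<in> ksubsets ({1..n} - B) l" "J \<in> ksubsets ({1..n} - B) l"
          and eq: "insert (Suc n) I = insert (Suc n) J"
        then have "Suc n \<notin> I" "Suc n \<notin> J" using notin by blast+
        with eq show "I = J" by (simp add: insert_ident)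
      qed
      have split: "ksubsets ({1..Suc n} - B) k =
          ksubsets ({1..n} - B) k \<union> insert (Suc n) ` ksubsets ({1..n} - B) l" (is "?L = ?R")
      proof (intro Set.set_eqI iffI)
        fix J assume J: "J \<in> ?L"
        show "J \<in> ?R"
        proof (cases "Suc n \<in> J")
          case True
          then have eq: "insert (Suc n) (J - {Suc n}) = J" by blast
          have J': "J - {Suc n} \<subseteq> {1..n} - B" using J unfolding ksubsets_def by force
          then have "J - {Suc n} \<in> ksubsets ({1..n} - B) l"
            using J ins[of "J - {Suc n}"] Suc unfolding eq ksubsets_def by auto
          then have "insert (Suc n) (J - {Suc n}) \<in> insert (Suc n) ` ksubsets ({1..n} - B) l"
            by (rule imageI)
          then show ?thesis unfolding eq by (rule UnI2)
        next
          case False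
          then have "J \<subseteq> {1..n} - B" using J unfolding ksubsets_def by (force simp: le_Suc_eq)
          then show ?thesis using J unfolding ksubsets_def by auto
        qed
      next
        fix J assume "J \<in> ?R"
        then show "J \<in> ?L"
        proof
          assume "J \<in> ksubsets ({1..n} - B) k"
          then show ?thesis unfolding ksubsets_def by auto
        next
          assume "J \<in> insert (Suc n) ` ksubsets ({1..n} - B) l"
          then obtain J' where J': "J = insert (Suc n) J'" "J' \<subseteq> {1..n} - B" "card J' = l"
            unfolding ksubsets_def by blast
          have "card J = k" using ins[of J'] J' Suc by auto
          moreover have "Suc n \<notin> B" using sub by auto
          ultimately show ?thesis using J' unfolding ksubsets_def by auto
        qed
      qed
      have disj: "ksubsets ({1..n} - B) k \<inter> insert (Suc n) ` ksubsets ({1..n} - B) l = {}"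
        using notin by auto
      have "ballot_set (Suc n) B" using B ballot_set_Suc[OF sub] by simp
      then have "\<zero> = (\<Oplus>J\<in>ksubsets ({1..Suc n} - B) k. g J)" using sum0 B(2) by simp
      also have "\<dots> = Sg B \<oplus> (\<Oplus>J\<in>insert (Suc n) ` ksubsets ({1..n} - B) l. g J)"
        unfolding split Sg_def using gB[of B] hB[of B] disj
        by (intro add.finprod_Un_disjoint) (auto simp: finite_ksubsets h_def Pi_def)
      also have "(\<Oplus>J\<in>insert (Suc n) ` ksubsets ({1..n} - B) l. g J) = Sh B"
        unfolding Sh_def h_def using inj hB[of B]
        by (intro add.finprod_reindex) (auto simp: h_def Pi_def)
      finally show ?thesis ..
    qed
    have one: "Sg B = \<zero>" if B: "ballot_set n B" "Suc (card B) \<le> min k (Suc n - k)" for B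
    proof -
      note sub = ballot_set_subset[OF B(1)]
      have "ballot_set (Suc n) (insert (Suc n) B)"
        using ballot_set_insert_Suc[OF sub] B by auto
      moreover have "{1..Suc n} - insert (Suc n) B = {1..n} - B" by (auto simp: le_Suc_eq)
      ultimately show ?thesis
        unfolding Sg_def using sum0[of "insert (Suc n) B"] B(2) ins[OF sub] by simp
    qed
    have other: "Sh B = \<zero>" if "Sg B = \<zero>" "Sg B \<oplus> Sh B = \<zero>" for B using that Sh by simp
    have other': "Sg B = \<zero>" if "Sh B = \<zero>" "Sg B \<oplus> Sh B = \<zero>" for B using that Sg by simp
    have "(\<forall>J\<in>ksubsets {1..n} k. g J = \<zero>) \<and> (\<forall>J\<in>ksubsets {1..n} l. h J = \<zero>)"
    \<comment> \<open>Below the middle, the ballot sets that determine \<open>h\<close> have at most \<open>k - 1\<close> elements and can all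
      be extended by the largest point; above the middle, this holds for those that determine \<open>g\<close>.\<close>
    proof (cases "2 * k \<le> Suc n")
      case True
      have h0: "\<forall>J\<in>ksubsets {1..n} l. h J = \<zero>"
      proof
        fix J assume J: "J \<in> ksubsets {1..n} l"
        show "h J = \<zero>"
        proof (rule Suc.IH[OF h' _ J])
          fix B assume B: "ballot_set n B" "card B \<le> min l (n - l)"
          then have "Suc (card B) \<le> min k (Suc n - k)" using True Suc by auto
          then have "Sh B = \<zero>" using B(1) by (intro other one both) auto
          then show "(\<Oplus>J\<in>ksubsets ({1..n} - B) l. h J) = \<zero>" unfolding Sh_def .
        qed
      qed
      have "Sh B = \<zero>" for B
        unfolding Sh_def using h0 by (intro add.finprod_one_eqI) (auto simp: ksubsets_def)
      then have g0: "Sg B = \<zero>" if "ballot_set n B" "card B \<le> min k (n - k)" for B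
        using that by (intro other' both) auto
      have "g J = \<zero>" if J: "J \<in> ksubsets {1..n} k" for J
        by (rule Suc.IH[OF g' _ J]) (use g0 in \<open>auto simp: Sg_def\<close>)
      with h0 show ?thesis by blast
    next
      case False
      have g0: "\<forall>J\<in>ksubsets {1..n} k. g J = \<zero>"
      proof
        fix J assume J: "J \<in> ksubsets {1..n} k"
        have "k \<le> n" using J card_mono[of "{1..n}" J] unfolding ksubsets_def by auto
        show "g J = \<zero>"
        proof (rule Suc.IH[OF g' _ J])
          fix B assume B: "ballot_set n B" "card B \<le> min k (n - k)"
          then have "Suc (card B) \<le> min k (Suc n - k)" using False \<open>k \<le> n\<close> by auto
          then have "Sg B = \<zero>" by (rule one[OF B(1)])
          then show "(\<Oplus>J\<in>ksubsets ({1..n} - B) k. g J) = \<zero>" unfolding Sg_def .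
        qed
      qed
      have "Sg B = \<zero>" for B
        unfolding Sg_def using g0 by (intro add.finprod_one_eqI) (auto simp: ksubsets_def)
      then have h0: "Sh B = \<zero>" if "ballot_set n B" "card B \<le> min l (n - l)" for B
        using that Suc by (intro other both) auto
      have "h J = \<zero>" if J: "J \<in> ksubsets {1..n} l" for J
        by (rule Suc.IH[OF h' _ J]) (use h0 in \<open>auto simp: Sh_def\<close>)
      with g0 show ?thesis by blast
    qed
    note gh0 = this
    show ?thesis
    proof (cases "Suc n \<in> J")
      case True
      then have eq: "insert (Suc n) (J - {Suc n}) = J" by blast
      have J': "J - {Suc n} \<subseteq> {1..n}" using Suc.prems(3) unfolding ksubsets_def by force
      then have "J - {Suc n} \<in> ksubsets {1..n} l"
        using Suc.prems(3) ins[OF J'] Suc unfolding eq ksubsets_def by auto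
      with gh0 have "h (J - {Suc n}) = \<zero>" by blast
      then show ?thesis unfolding h_def eq .
    next
      case False
      then have "J \<in> ksubsets {1..n} k"
        using Suc.prems(3) unfolding ksubsets_def by (force simp: le_Suc_eq)
      with gh0 show ?thesis by blast
    qed
  qed
qed


section \<open>Polynomial functions and the Vandermonde product\<close>

context cring
begin

fun horner :: "'a list \<Rightarrow> 'a \<Rightarrow> 'a" where
  "horner [] y = \<zero>"
| "horner (c # cs) y = c \<oplus> y \<otimes> horner cs y"

lemma horner_closed: "set cs \<subseteq> carrier R \<Longrightarrow> y \<in> carrier R \<Longrightarrow> horner cs y \<in> carrier R"
  by (induction cs) auto

text \<open>Synthetic division: the coefficients of \<open>(p(y) - p(a)) / (y - a)\<close>, where \<open>p\<close> has the given
coefficients, lowest degree first.\<close>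

fun quotient_coeffs :: "'a \<Rightarrow> 'a list \<Rightarrow> 'a list" where
  "quotient_coeffs a (c # d # cs) = horner (d # cs) a # quotient_coeffs a (d # cs)"
| "quotient_coeffs a cs = []"

lemma length_quotient_coeffs: "length (quotient_coeffs a cs) = length cs - 1"
  by (induction a cs rule: quotient_coeffs.induct) auto

lemma quotient_coeffs_closed:
  "set cs \<subseteq> carrier R \<Longrightarrow> a \<in> carrier R \<Longrightarrow> set (quotient_coeffs a cs) \<subseteq> carrier R"
  by (induction a cs rule: quotient_coeffs.induct) (auto intro!: horner_closed simp del: horner.simps)

lemma horner_division:
  assumes "set cs \<subseteq> carrier R" "a \<in> carrier R" "y \<in> carrier R"
  shows "horner cs y = horner cs a \<oplus> (y \<ominus> a) \<otimes> horner (quotient_coeffs a cs) y"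
  using assms
proof (induction a cs rule: quotient_coeffs.induct)
  case (1 a c d cs)
  define p where "p = horner (d # cs) y"
  define r where "r = horner (d # cs) a"
  define q where "q = horner (quotient_coeffs a (d # cs)) y"
  have cl: "p \<in> carrier R" "r \<in> carrier R" "q \<in> carrier R" "c \<in> carrier R"
    using 1(2,3,4) quotient_coeffs_closed[of "d # cs" a] unfolding p_def r_def q_def
    by (auto intro!: horner_closed simp del: horner.simps)
  have IH: "p = r \<oplus> (y \<ominus> a) \<otimes> q"
    unfolding p_def r_def q_def using 1 by (intro "1.IH") auto
  have "c \<oplus> y \<otimes> (r \<oplus> (y \<ominus> a) \<otimes> q) = (c \<oplus> a \<otimes> r) \<oplus> (y \<ominus> a) \<otimes> (r \<oplus> y \<otimes> q)"
    using cl 1(3,4) by algebra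
  then have "c \<oplus> y \<otimes> p = (c \<oplus> a \<otimes> r) \<oplus> (y \<ominus> a) \<otimes> (r \<oplus> y \<otimes> q)" unfolding IH .
  moreover have "horner (c # d # cs) y = c \<oplus> y \<otimes> p" "horner (c # d # cs) a = c \<oplus> a \<otimes> r"
    "horner (quotient_coeffs a (c # d # cs)) y = r \<oplus> y \<otimes> q"
    unfolding p_def r_def q_def by simp_all
  ultimately show ?case by (simp only:)
qed (auto simp: r_neg)

text \<open>The polynomial is recovered from its value at \<open>a\<close> and its quotient by \<open>y - a\<close>, so whatever annihilates
these annihilates its coefficients.\<close>

lemma annihilates_coeffs_of_quotient:
  assumes "set cs \<subseteq> carrier R" "a \<in> carrier R" "t \<in> carrier R"
    and "\<forall>c\<in>set (quotient_coeffs a cs). t \<otimes> c = \<zero>" "t \<otimes> horner cs a = \<zero>"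
  shows "\<forall>c\<in>set cs. t \<otimes> c = \<zero>"
  using assms
proof (induction a cs rule: quotient_coeffs.induct)
  case (1 a c d cs)
  define r where "r = horner (d # cs) a"
  have r: "r \<in> carrier R" and c: "c \<in> carrier R"
    using 1 unfolding r_def by (auto intro!: horner_closed simp del: horner.simps)
  have tr: "t \<otimes> r = \<zero>" using 1 unfolding r_def by simp
  then have rest: "\<forall>c\<in>set (d # cs). t \<otimes> c = \<zero>" using 1 unfolding r_def by simp
  have "t \<otimes> c = t \<otimes> (c \<oplus> a \<otimes> r) \<ominus> a \<otimes> (t \<otimes> r)" using r c 1(3,4) by algebra
  also have "t \<otimes> (c \<oplus> a \<otimes> r) = \<zero>" using 1(6) unfolding r_def by simp
  finally have "t \<otimes> c = \<zero>" using tr 1(3) by (simp add: r_neg minus_eq)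
  with rest show ?case by simp
qed auto

lemma finprod_annihilates:
  assumes "finite A" "i \<in> A" "f \<in> A \<rightarrow> carrier R" "t \<in> carrier R" "c \<in> carrier R"
    and "t \<otimes> (f i \<otimes> c) = \<zero>"
  shows "(t \<otimes> finprod R f A) \<otimes> c = \<zero>"
proof -
  have A: "insert i (A - {i}) = A" using assms(2) by blast
  define p where "p = finprod R f (A - {i})"
  have cl: "p \<in> carrier R" "f i \<in> carrier R"
    using assms(2,3) by (auto simp: p_def Pi_iff intro!: finprod_closed)
  have "finprod R f (insert i (A - {i})) = f i \<otimes> p"
    unfolding p_def using assms(1,2,3) by (intro finprod_insert) auto
  then have "(t \<otimes> finprod R f A) \<otimes> c = (t \<otimes> (f i \<otimes> p)) \<otimes> c" by (simp only: A)
  also have "\<dots> = p \<otimes> (t \<otimes> (f i \<otimes> c))" using cl assms(4,5) by algebra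
  finally show ?thesis using assms(6) cl by simp
qed

definition vandermonde_product :: "nat \<Rightarrow> (nat \<Rightarrow> 'a) \<Rightarrow> 'a" where
  "vandermonde_product n x =
     (\<Otimes>p \<in> {(j, k). 1 \<le> j \<and> j < k \<and> k \<le> n}. x (fst p) \<ominus> x (snd p))"

lemma finite_ordered_pairs: "finite {(j, k). 1 \<le> j \<and> j < k \<and> k \<le> (n::nat)}"
  by (rule finite_subset[of _ "{1..n} \<times> {1..n}"]) auto

lemma vandermonde_product_closed:
  "x \<in> {1..n} \<rightarrow> carrier R \<Longrightarrow> vandermonde_product n x \<in> carrier R"
  unfolding vandermonde_product_def by (intro finprod_closed) (auto simp: Pi_iff)

lemma vandermonde_product_Suc:
  assumes x: "x \<in> {1..Suc n} \<rightarrow> carrier R"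
  shows "vandermonde_product (Suc n) x =
    vandermonde_product n x \<otimes> (\<Otimes>j\<in>{1..n}. x j \<ominus> x (Suc n))"
proof -
  let ?P = "\<lambda>n. {(j, k). 1 \<le> j \<and> j < k \<and> k \<le> (n::nat)}"
  have split: "?P (Suc n) = ?P n \<union> (\<lambda>j. (j, Suc n)) ` {1..n}" by auto
  have inj: "inj_on (\<lambda>j. (j, Suc n)) {1..n}" by (auto simp: inj_on_def)
  have "vandermonde_product (Suc n) x = vandermonde_product n x \<otimes>
      (\<Otimes>p \<in> (\<lambda>j. (j, Suc n)) ` {1..n}. x (fst p) \<ominus> x (snd p))"
    unfolding vandermonde_product_def split
    using x by (intro finprod_Un_disjoint finite_ordered_pairs) (auto simp: Pi_iff)
  also have "(\<Otimes>p \<in> (\<lambda>j. (j, Suc n)) ` {1..n}. x (fst p) \<ominus> x (snd p)) =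
      (\<Otimes>j\<in>{1..n}. x j \<ominus> x (Suc n))"
    using x by (subst finprod_reindex[OF _ inj]) (auto simp: Pi_iff)
  finally show ?thesis .
qed

text \<open>The statement \<open>det V \<cdot> c = 0\<close> for \<open>V c = 0\<close> with a Vandermonde matrix \<open>V\<close>, by Newton's divided
differences instead of determinants: at the remaining points, the quotient by \<open>y - x\<^sub>n\<close> is annihilated
after multiplication with the differences \<open>x\<^sub>j - x\<^sub>n\<close>.  The factor \<open>t\<close> carries these differences
through the induction.\<close>

lemma vandermonde_product_annihilates_coeffs:
  assumes "x \<in> {1..n} \<rightarrow> carrier R" "t \<in> carrier R" "set cs \<subseteq> carrier R" "length cs = n"
    and "\<forall>j\<in>{1..n}. t \<otimes> horner cs (x j) = \<zero>"
  shows "\<forall>c\<in>set cs. (t \<otimes> vandermonde_product n x) \<otimes> c = \<zero>"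
  using assms
proof (induction n arbitrary: t cs)
  case (Suc n)
  note x = Suc.prems(1) and t = Suc.prems(2) and cs = Suc.prems(3)
  define a where "a = x (Suc n)"
  define d where "d = (\<Otimes>j\<in>{1..n}. x j \<ominus> a)"
  have a: "a \<in> carrier R" using x by (auto simp: a_def)
  have xs: "x j \<in> carrier R" if "j \<in> {1..n}" for j using x that by (auto simp: Pi_iff)
  have dcl: "(\<lambda>j. x j \<ominus> a) \<in> {1..n} \<rightarrow> carrier R" using xs a by auto
  then have d: "d \<in> carrier R" unfolding d_def by (rule finprod_closed)
  have V: "vandermonde_product n x \<in> carrier R"
    using xs by (auto intro: vandermonde_product_closed)
  note q = quotient_coeffs_closed[OF cs a]
  have "\<forall>j\<in>{1..n}. (t \<otimes> d) \<otimes> horner (quotient_coeffs a cs) (x j) = \<zero>"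
  proof
    fix j assume j: "j \<in> {1..n}"
    have cl: "horner (quotient_coeffs a cs) (x j) \<in> carrier R" "horner cs a \<in> carrier R"
      "x j \<in> carrier R"
      using horner_closed q cs xs[OF j] a by auto
    have "t \<otimes> ((x j \<ominus> a) \<otimes> horner (quotient_coeffs a cs) (x j)) =
        t \<otimes> (horner cs a \<oplus> (x j \<ominus> a) \<otimes> horner (quotient_coeffs a cs) (x j)) \<ominus> t \<otimes> horner cs a"
      using cl a t by algebra
    also have "\<dots> = \<zero>"
      using Suc.prems(5) j cl by (subst horner_division[OF cs a cl(3), symmetric]) (auto simp: a_def r_neg minus_eq)
    finally show "(t \<otimes> d) \<otimes> horner (quotient_coeffs a cs) (x j) = \<zero>"
      unfolding d_def using j dcl t cl by (intro finprod_annihilates[of _ j]) auto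
  qed
  then have 1: "\<forall>c\<in>set (quotient_coeffs a cs). ((t \<otimes> d) \<otimes> vandermonde_product n x) \<otimes> c = \<zero>"
    using xs t d q Suc.prems(4) by (intro Suc.IH) (auto simp: length_quotient_coeffs)
  have T: "(t \<otimes> d) \<otimes> vandermonde_product n x = t \<otimes> vandermonde_product (Suc n) x"
    unfolding vandermonde_product_Suc[OF x] d_def[unfolded a_def, symmetric]
    using t d V by algebra
  define h where "h = horner cs a"
  have h: "h \<in> carrier R" "t \<otimes> h = \<zero>"
    using horner_closed[OF cs a] Suc.prems(5) by (auto simp: h_def a_def)
  have "((t \<otimes> d) \<otimes> vandermonde_product n x) \<otimes> h = d \<otimes> vandermonde_product n x \<otimes> (t \<otimes> h)"
    using t d V h(1) by algebra
  then have 2: "((t \<otimes> d) \<otimes> vandermonde_product n x) \<otimes> horner cs a = \<zero>"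
    using h d V by (simp flip: h_def)
  show ?case
    using annihilates_coeffs_of_quotient[OF cs a _ 1 2] t d V unfolding T[symmetric] by simp
qed simp

lemma vandermonde_value_eq:
  "vandermonde_value R n x = (\<Otimes>j\<in>{1..n}. x j) \<otimes> vandermonde_product n x"
  unfolding vandermonde_value_def vandermonde_product_def ..

text \<open>The extra factor \<open>x\<^sub>1 \<cdots> x\<^sub>n\<close> of \<open>p\<^sub>n\<close> comes from the missing constant term: only
\<open>r * p(r)\<close> is known to vanish.\<close>

lemma vandermonde_value_annihilates_coeffs:
  assumes cs: "set cs \<subseteq> carrier R" "length cs = n"
    and "\<And>r. r \<in> carrier R \<Longrightarrow> r \<otimes> horner cs r = \<zero>"
    and x: "x \<in> {1..n} \<rightarrow> carrier R" and c: "c \<in> set cs"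
  shows "vandermonde_value R n x \<otimes> c = \<zero>"
proof -
  let ?t = "\<Otimes>j\<in>{1..n}. x j"
  have t: "?t \<in> carrier R" using x by (rule finprod_closed)
  have "?t \<otimes> horner cs (x j) = \<zero>" if j: "j \<in> {1..n}" for j
  proof -
    have xj: "x j \<in> carrier R" using x j by auto
    have h: "horner cs (x j) \<in> carrier R" using horner_closed cs xj by auto
    have "\<one> \<otimes> (x j \<otimes> horner cs (x j)) = \<zero>" using assms(3)[OF xj] by simp
    then have "(\<one> \<otimes> ?t) \<otimes> horner cs (x j) = \<zero>"
      using x h j by (intro finprod_annihilates[of _ j]) auto
    then show ?thesis using t by simp
  qed
  then show ?thesis
    unfolding vandermonde_value_eq
    using vandermonde_product_annihilates_coeffs[OF x t cs] c by blast
qed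

lemma annihilator_ideal:
  assumes a: "a \<in> carrier R"
  shows "ideal {y \<in> carrier R. a \<otimes> y = \<zero>} R"
proof (rule idealI)
  show "ring R" ..
  show "subgroup {y \<in> carrier R. a \<otimes> y = \<zero>} (add_monoid R)"
    using a by (intro add.subgroupI) (auto simp: r_distr r_minus)
  fix y z assume "y \<in> {y \<in> carrier R. a \<otimes> y = \<zero>}" and z: "z \<in> carrier R"
  then have y: "y \<in> carrier R" "a \<otimes> y = \<zero>" by auto
  have "a \<otimes> (z \<otimes> y) = z \<otimes> (a \<otimes> y)" "a \<otimes> (y \<otimes> z) = z \<otimes> (a \<otimes> y)"
    using a y(1) z by algebra+
  then show "z \<otimes> y \<in> {y \<in> carrier R. a \<otimes> y = \<zero>}" "y \<otimes> z \<in> {y \<in> carrier R. a \<otimes> y = \<zero>}"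
    using y z by auto
qed

text \<open>An element annihilates an ideal as soon as it annihilates generators.\<close>

lemma vandermonde_full_iff:
  "vandermonde_full R n \<longleftrightarrow>
    (\<forall>a\<in>carrier R. (\<forall>x\<in>vecs R n. a \<otimes> vandermonde_value R n x = \<zero>) \<longrightarrow> a = \<zero>)"
proof -
  let ?V = "vandermonde_value R n ` vecs R n"
  have xc: "x \<in> {1..n} \<rightarrow> carrier R" if "x \<in> vecs R n" for x
    using that by (auto simp: vecs_def)
  have V: "?V \<subseteq> carrier R"
    unfolding vandermonde_value_eq
    using xc vandermonde_product_closed by (auto intro!: m_closed finprod_closed)
  have "annihilator R (vandermonde_ideal R n) =
      {a \<in> carrier R. \<forall>x\<in>vecs R n. a \<otimes> vandermonde_value R n x = \<zero>}"
  proof (intro equalityI subsetI)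
    fix a assume "a \<in> annihilator R (vandermonde_ideal R n)"
    then show "a \<in> {a \<in> carrier R. \<forall>x\<in>vecs R n. a \<otimes> vandermonde_value R n x = \<zero>}"
      using genideal_self[OF V] unfolding annihilator_def vandermonde_ideal_def by auto
  next
    fix a assume a: "a \<in> {a \<in> carrier R. \<forall>x\<in>vecs R n. a \<otimes> vandermonde_value R n x = \<zero>}"
    have "ideal {y \<in> carrier R. a \<otimes> y = \<zero>} R"
      using a by (intro annihilator_ideal) auto
    then have "vandermonde_ideal R n \<subseteq> {y \<in> carrier R. a \<otimes> y = \<zero>}"
      unfolding vandermonde_ideal_def using a V by (intro genideal_minimal) auto
    then show "a \<in> annihilator R (vandermonde_ideal R n)"
      using a unfolding annihilator_def by auto
  qed
  moreover have "\<zero> \<otimes> vandermonde_value R n x = \<zero>" if "x \<in> vecs R n" for x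
    using V that by auto
  ultimately show ?thesis unfolding vandermonde_full_def by auto
qed

end


section \<open>Linear systems with more unknowns than equations\<close>

context cring
begin

text \<open>Multiply successively by the highest power of each \<open>c i\<close> that does not yet lead into \<open>D\<close>.\<close>

lemma nilpotent_family_multiplier:
  assumes D: "ideal D R" "\<one> \<notin> D" and "finite A" "c \<in> A \<rightarrow> carrier R"
    and "\<forall>i\<in>A. \<exists>K::nat. c i [^] K \<in> D"
  shows "\<exists>t\<in>carrier R. t \<notin> D \<and> (\<forall>i\<in>A. t \<otimes> c i \<in> D)"
  using assms(3,4,5)
proof (induction A rule: finite_induct)
  case empty
  show ?case using D(2) by (intro bexI[of _ \<one>]) auto
next
  case (insert i A)
  interpret D: ideal D R by (rule D(1))
  have ci: "c i \<in> carrier R" using insert.prems by auto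
  obtain t where t: "t \<in> carrier R" "t \<notin> D" "\<forall>j\<in>A. t \<otimes> c j \<in> D"
    using insert by auto
  have ex: "\<exists>K::nat. t \<otimes> c i [^] K \<in> D"
    using insert.prems(2) t(1) by (metis D.I_l_closed insertI1)
  define K where "K = (LEAST K::nat. t \<otimes> c i [^] K \<in> D)"
  have K: "t \<otimes> c i [^] K \<in> D" unfolding K_def using ex by (rule LeastI_ex)
  have "K \<noteq> 0"
  proof
    assume "K = 0"
    with K t show False by simp
  qed
  then obtain L where L: "K = Suc L" using not0_implies_Suc by blast
  have notin: "t \<otimes> c i [^] L \<notin> D" using not_less_Least[of L "\<lambda>K. t \<otimes> c i [^] K \<in> D"] L unfolding K_def by auto
  have in_D: "(t \<otimes> c i [^] L) \<otimes> c i \<in> D" using K t(1) ci unfolding L by (simp add: m_assoc)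
  have "(t \<otimes> c i [^] L) \<otimes> c j \<in> D" if j: "j \<in> A" for j
  proof -
    have cj: "c j \<in> carrier R" using j insert.prems by auto
    have "(t \<otimes> c i [^] L) \<otimes> c j = c i [^] L \<otimes> (t \<otimes> c j)"
      using t(1) ci cj by (simp add: m_ac)
    then show ?thesis using t(3) j ci D.I_l_closed by simp
  qed
  with notin in_D t(1) ci show ?case by (intro bexI[of _ "t \<otimes> c i [^] L"]) auto
qed

lemma transporter_ideal:
  assumes D: "ideal D R" and t: "t \<in> carrier R"
  shows "ideal {x \<in> carrier R. t \<otimes> x \<in> D} R"
proof (rule idealI)
  interpret D: ideal D R by (rule D)
  show "ring R" ..
  show "subgroup {x \<in> carrier R. t \<otimes> x \<in> D} (add_monoid R)"
    using t by (intro add.subgroupI) (auto simp: r_distr r_minus intro: D.a_closed D.a_inv_closed)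
  fix y z assume "y \<in> {x \<in> carrier R. t \<otimes> x \<in> D}" and z: "z \<in> carrier R"
  then have y: "y \<in> carrier R" "t \<otimes> y \<in> D" by auto
  have "t \<otimes> (z \<otimes> y) = z \<otimes> (t \<otimes> y)" "t \<otimes> (y \<otimes> z) = z \<otimes> (t \<otimes> y)"
    using t y(1) z by algebra+
  then show "z \<otimes> y \<in> {x \<in> carrier R. t \<otimes> x \<in> D}" "y \<otimes> z \<in> {x \<in> carrier R. t \<otimes> x \<in> D}"
    using y z D.I_l_closed by auto
qed

text \<open>The kernel of the map from \<open>R\<close> to the localization of \<open>R/D\<close> at \<open>c\<close>.\<close>

lemma saturation_ideal:
  assumes D: "ideal D R" and c: "c \<in> carrier R"
  shows "ideal {x \<in> carrier R. \<exists>K::nat. c [^] K \<otimes> x \<in> D} R" (is "ideal ?S R")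
proof (rule idealI)
  interpret D: ideal D R by (rule D)
  show "ring R" ..
  show "subgroup ?S (add_monoid R)"
  proof (rule add.subgroupI)
    show "?S \<subseteq> carrier R" by auto
    have "c [^] (0::nat) \<otimes> \<zero> \<in> D" by simp
    then show "?S \<noteq> {}" by blast
    fix x assume "x \<in> ?S"
    then obtain K :: nat where x: "x \<in> carrier R" "c [^] K \<otimes> x \<in> D" by auto
    have "c [^] K \<otimes> \<ominus> x \<in> D" using x c by (simp add: r_minus)
    then show "\<ominus> x \<in> ?S" using x by auto
    fix y assume "y \<in> ?S"
    then obtain L :: nat where y: "y \<in> carrier R" "c [^] L \<otimes> y \<in> D" by auto
    have p: "c [^] K \<in> carrier R" "c [^] L \<in> carrier R" using c by simp_all
    have "c [^] (K + L) \<otimes> (x \<oplus> y) =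
        c [^] L \<otimes> (c [^] K \<otimes> x) \<oplus> c [^] K \<otimes> (c [^] L \<otimes> y)"
      unfolding nat_pow_mult[OF c, symmetric] using x(1) y(1) p by algebra
    also have "\<dots> \<in> D" using D.I_l_closed[OF x(2) p(2)] D.I_l_closed[OF y(2) p(1)] by (rule D.a_closed)
    finally show "x \<oplus> y \<in> ?S" using x y by blast
  qed
  fix y z assume "y \<in> ?S" and z: "z \<in> carrier R"
  then obtain K :: nat where y: "y \<in> carrier R" "c [^] K \<otimes> y \<in> D" by auto
  have p: "c [^] K \<in> carrier R" using c by simp
  have "c [^] K \<otimes> (z \<otimes> y) = z \<otimes> (c [^] K \<otimes> y)" "c [^] K \<otimes> (y \<otimes> z) = z \<otimes> (c [^] K \<otimes> y)"
    using p y(1) z by algebra+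
  then have "c [^] K \<otimes> (z \<otimes> y) \<in> D" "c [^] K \<otimes> (y \<otimes> z) \<in> D"
    using y z D.I_l_closed by auto
  then show "z \<otimes> y \<in> ?S" "y \<otimes> z \<in> ?S" using y z by auto
qed

lemma saturation_uniform_exponent:
  assumes D: "ideal D R" and c: "c \<in> carrier R" and "finite E"
    and "\<forall>e\<in>E. x e \<in> carrier R \<and> (\<exists>K::nat. c [^] K \<otimes> x e \<in> D)"
  shows "\<exists>K::nat. \<forall>e\<in>E. c [^] K \<otimes> x e \<in> D"
  using assms(3,4)
proof (induction E rule: finite_induct)
  case (insert e E)
  interpret D: ideal D R by (rule D)
  obtain K L :: nat where K: "\<forall>e\<in>E. c [^] K \<otimes> x e \<in> D" and L: "c [^] L \<otimes> x e \<in> D"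
    using insert by auto
  have p: "c [^] K \<in> carrier R" "c [^] L \<in> carrier R" using c by simp_all
  have "c [^] (K + L) \<otimes> x d \<in> D" if d: "d \<in> insert e E" for d
  proof -
    have xd: "x d \<in> carrier R" using d insert.prems by auto
    have "c [^] (K + L) \<otimes> x d = c [^] L \<otimes> (c [^] K \<otimes> x d)"
      "c [^] (K + L) \<otimes> x d = c [^] K \<otimes> (c [^] L \<otimes> x d)"
      unfolding nat_pow_mult[OF c, symmetric] using p xd by algebra+
    then show ?thesis using d K L p D.I_l_closed by (metis insertE)
  qed
  then show ?case by blast
qed simp

lemma ideal_finsum_closed:
  assumes D: "ideal D R" and "finite A" and "\<And>j. j \<in> A \<Longrightarrow> f j \<in> D"
  shows "finsum R f A \<in> D"
  using assms(2,3)
proof (induction A rule: finite_induct)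
  case (insert j A)
  interpret D: ideal D R by (rule D)
  have "f \<in> A \<rightarrow> carrier R" "f j \<in> carrier R" using insert.prems D.Icarr by auto
  then show ?case using insert by (simp add: finsum_insert)
qed (simp add: additive_subgroup.zero_closed[OF ideal.axioms(1)[OF D]])

text \<open>Induction on the number of equations, with the ideal \<open>D\<close> variable so that quotients and localizations
of \<open>R\<close> need not be constructed.  Let \<open>c j\<close> be the coefficients of the last equation.  If some \<open>c i\<close> is not
nilpotent modulo \<open>D\<close>, then it can be used as a pivot: eliminate the unknown \<open>i\<close> and solve the remaining
equations modulo the saturation of \<open>D\<close> by \<open>c i\<close>.  Otherwise there is \<open>t \<notin> D\<close> with \<open>t * c j \<in> D\<close>
for all \<open>j\<close>; then \<open>t\<close> times a solution of the other equations modulo \<open>{x. t * x \<in> D}\<close> solves the last one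
as well.\<close>

lemma underdetermined_system_mod_ideal:
  assumes "finite E" "finite A" "card E < card A"
    and "\<And>e j. e \<in> E \<Longrightarrow> j \<in> A \<Longrightarrow> M e j \<in> carrier R"
    and "ideal D R" "\<one> \<notin> D"
  shows "\<exists>b\<in>A \<rightarrow> carrier R. (\<exists>j\<in>A. b j \<notin> D) \<and>
    (\<forall>e\<in>E. (\<Oplus>j\<in>A. b j \<otimes> M e j) \<in> D)"
  using assms
proof (induction E arbitrary: A M D rule: finite_induct)
  case empty
  then have "A \<noteq> {}" by auto
  then show ?case using empty by (intro bexI[of _ "\<lambda>_. \<one>"]) auto
next
  case (insert d E)
  note finA = insert.prems(1) and M = insert.prems(3) and D = insert.prems(4,5)
  interpret D: ideal D R by (rule D(1))
  define c where "c = M d"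
  have c: "c j \<in> carrier R" if "j \<in> A" for j using M that by (simp add: c_def)
  show ?case
  proof (cases "\<forall>i\<in>A. \<exists>K::nat. c i [^] K \<in> D")
    case True
    obtain t where t: "t \<in> carrier R" "t \<notin> D" "\<forall>i\<in>A. t \<otimes> c i \<in> D"
      using nilpotent_family_multiplier[OF D finA _ True] c by auto
    have "\<exists>b\<in>A \<rightarrow> carrier R. (\<exists>j\<in>A. b j \<notin> {x \<in> carrier R. t \<otimes> x \<in> D}) \<and>
        (\<forall>e\<in>E. (\<Oplus>j\<in>A. b j \<otimes> M e j) \<in> {x \<in> carrier R. t \<otimes> x \<in> D})"
      using insert.prems insert.hyps t
      by (intro insert.IH transporter_ideal) auto
    then obtain b where b: "b \<in> A \<rightarrow> carrier R" "\<exists>j\<in>A. t \<otimes> b j \<notin> D"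
      "\<forall>e\<in>E. t \<otimes> (\<Oplus>j\<in>A. b j \<otimes> M e j) \<in> D" by blast
    have bc: "b j \<in> carrier R" if "j \<in> A" for j using b(1) that by auto
    have "(\<Oplus>j\<in>A. (t \<otimes> b j) \<otimes> M e j) \<in> D" if e: "e \<in> insert d E" for e
    proof -
      have Me: "M e j \<in> carrier R" if "j \<in> A" for j using M e that by simp
      have sum: "(\<Oplus>j\<in>A. (t \<otimes> b j) \<otimes> M e j) = t \<otimes> (\<Oplus>j\<in>A. b j \<otimes> M e j)"
        using t(1) bc Me finA
        by (subst finsum_rdistr) (auto simp: m_assoc intro!: finsum_cong')
      show ?thesis
      proof (cases "e = d")
        case True
        have "(t \<otimes> b j) \<otimes> M e j \<in> D" if j: "j \<in> A" for j
        proof -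
          have "(t \<otimes> b j) \<otimes> M e j = b j \<otimes> (t \<otimes> c j)"
            using t(1) bc[OF j] c[OF j] True by (simp add: m_ac c_def)
          then show ?thesis using t(3) j bc D.I_l_closed by simp
        qed
        then show ?thesis using ideal_finsum_closed[OF D(1) finA] by simp
      next
        case False
        then show ?thesis using sum b(3) e by simp
      qed
    qed
    then show ?thesis using b(1,2) t(1) by (intro bexI[of _ "\<lambda>j. t \<otimes> b j"]) auto
  next
    case False
    then obtain i where i: "i \<in> A" "\<And>K::nat. c i [^] K \<notin> D" by blast
    define A' where "A' = A - {i}"
    have A: "A = insert i A'" "i \<notin> A'" "finite A'" using i finA by (auto simp: A'_def)
    define M' where "M' e j = c i \<otimes> M e j \<ominus> c j \<otimes> M e i" for e j
    let ?S = "{x \<in> carrier R. \<exists>K::nat. c i [^] K \<otimes> x \<in> D}"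
    note ci = c[OF i(1)]
    have M': "M' e j \<in> carrier R" if "e \<in> insert d E" "j \<in> A'" for e j
      using that i(1) A c M by (auto simp: M'_def)
    have "\<exists>b\<in>A' \<rightarrow> carrier R. (\<exists>j\<in>A'. b j \<notin> ?S) \<and>
        (\<forall>e\<in>E. (\<Oplus>j\<in>A'. b j \<otimes> M' e j) \<in> ?S)"
    proof (rule insert.IH)
      show "card E < card A'" using insert.prems(2) insert.hyps A by simp
    qed (use A M' i(2) ci D in \<open>auto intro: saturation_ideal\<close>)
    then obtain b where b: "b \<in> A' \<rightarrow> carrier R" "\<exists>j\<in>A'. b j \<notin> ?S"
      "\<forall>e\<in>E. (\<Oplus>j\<in>A'. b j \<otimes> M' e j) \<in> ?S" by blast
    have bc: "b j \<in> carrier R" if "j \<in> A'" for j using b(1) that by auto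
    obtain K :: nat where K: "\<forall>e\<in>E. c i [^] K \<otimes> (\<Oplus>j\<in>A'. b j \<otimes> M' e j) \<in> D"
      using saturation_uniform_exponent[OF D(1) ci insert.hyps(1), of "\<lambda>e. \<Oplus>j\<in>A'. b j \<otimes> M' e j"] b(3)
      by auto
    \<comment> \<open>The power \<open>p\<close> leads from the saturation back into \<open>D\<close>.  With \<open>b' i\<close> chosen below, the last
      equation holds exactly and every other one becomes \<open>p\<close> times its reduced form.\<close>
    define p where "p = c i [^] K"
    have p: "p \<in> carrier R" using ci by (simp add: p_def)
    define s where "s = (\<Oplus>j\<in>A'. b j \<otimes> c j)"
    have cA': "c j \<in> carrier R" if "j \<in> A'" for j using that c A by simp
    have s: "s \<in> carrier R" unfolding s_def using bc cA' by (intro finsum_closed) auto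
    define b' where "b' j = (if j = i then \<ominus> (p \<otimes> s) else p \<otimes> (c i \<otimes> b j))" for j
    have b': "b' \<in> A \<rightarrow> carrier R" unfolding A using p s bc ci by (auto simp: b'_def)
    have row: "(\<Oplus>j\<in>A. b' j \<otimes> M e j) = p \<otimes> (\<Oplus>j\<in>A'. b j \<otimes> M' e j)" if e: "e \<in> insert d E" for e
    proof -
      have Mi: "M e i \<in> carrier R" and MA: "\<And>j. j \<in> A' \<Longrightarrow> M e j \<in> carrier R"
        using M e i(1) A by simp_all
      have "(\<Oplus>j\<in>A. b' j \<otimes> M e j) = b' i \<otimes> M e i \<oplus> (\<Oplus>j\<in>A'. b' j \<otimes> M e j)"
        unfolding A(1) using A Mi MA b' by (intro finsum_insert) auto
      also have "(\<Oplus>j\<in>A'. b' j \<otimes> M e j) = (\<Oplus>j\<in>A'. p \<otimes> (c i \<otimes> (b j \<otimes> M e j)))"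
        using A(2) p ci bc MA by (intro finsum_cong') (auto simp: b'_def m_assoc)
      also have "\<dots> = p \<otimes> (c i \<otimes> (\<Oplus>j\<in>A'. b j \<otimes> M e j))"
        using A(3) p ci bc MA by (simp add: finsum_rdistr)
      finally have 1: "(\<Oplus>j\<in>A. b' j \<otimes> M e j) =
          \<ominus> (p \<otimes> s) \<otimes> M e i \<oplus> p \<otimes> (c i \<otimes> (\<Oplus>j\<in>A'. b j \<otimes> M e j))"
        by (simp add: b'_def)
      define q where "q = (\<Oplus>j\<in>A'. b j \<otimes> M e j)"
      have q: "q \<in> carrier R" unfolding q_def using bc MA by (intro finsum_closed) auto
      have "(\<Oplus>j\<in>A'. b j \<otimes> M' e j) =
          (\<Oplus>j\<in>A'. c i \<otimes> (b j \<otimes> M e j) \<oplus> (\<ominus> M e i) \<otimes> (b j \<otimes> c j))"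
      proof (rule finsum_cong')
        fix j assume j: "j \<in> A'"
        show "b j \<otimes> M' e j = c i \<otimes> (b j \<otimes> M e j) \<oplus> (\<ominus> M e i) \<otimes> (b j \<otimes> c j)"
          unfolding M'_def using bc[OF j] MA[OF j] cA'[OF j] ci Mi by algebra
      qed (use bc MA cA' ci Mi in auto)
      also have "\<dots> = c i \<otimes> q \<oplus> (\<ominus> M e i) \<otimes> s"
        unfolding q_def s_def using bc MA cA' ci Mi A(3) by (simp add: finsum_addf finsum_rdistr Pi_iff)
      finally have "p \<otimes> (\<Oplus>j\<in>A'. b j \<otimes> M' e j) = p \<otimes> (c i \<otimes> q \<oplus> (\<ominus> M e i) \<otimes> s)" by simp
      also have "\<dots> = \<ominus> (p \<otimes> s) \<otimes> M e i \<oplus> p \<otimes> (c i \<otimes> q)"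
        using p s q ci Mi by algebra
      finally show ?thesis using 1 by (simp add: q_def)
    qed
    have "M' d j = \<zero>" if "j \<in> A'" for j
      using ci cA'[OF that] by (simp add: M'_def c_def[symmetric] m_comm r_neg minus_eq)
    then have "(\<Oplus>j\<in>A'. b j \<otimes> M' d j) = \<zero>"
      using bc by (intro add.finprod_one_eqI) auto
    then have "(\<Oplus>j\<in>A. b' j \<otimes> M e j) \<in> D" if "e \<in> insert d E" for e
      using row[OF that] K that p by (cases "e = d") (auto simp: p_def)
    moreover have "\<exists>j\<in>A. b' j \<notin> D"
    proof -
      obtain j where j: "j \<in> A'" "b j \<notin> ?S" using b(2) by blast
      have "b' j = c i [^] Suc K \<otimes> b j"
        using j(1) A(2) ci bc[OF j(1)] by (auto simp: b'_def p_def m_assoc)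
      moreover have "c i [^] Suc K \<otimes> b j \<notin> D" using j bc by blast
      ultimately show ?thesis using j(1) A(1) by (intro bexI[of _ j]) auto
    qed
    ultimately show ?thesis using b' by blast
  qed
qed

lemma underdetermined_system:
  assumes "\<one> \<noteq> \<zero>" "finite E" "finite A" "card E < card A"
    and "\<And>e j. e \<in> E \<Longrightarrow> j \<in> A \<Longrightarrow> M e j \<in> carrier R"
  shows "\<exists>b\<in>A \<rightarrow> carrier R. (\<exists>j\<in>A. b j \<noteq> \<zero>) \<and> (\<forall>e\<in>E. (\<Oplus>j\<in>A. b j \<otimes> M e j) = \<zero>)"
  using underdetermined_system_mod_ideal[OF assms(2-5) zeroideal] assms(1) by auto

end


section \<open>Vandermonde values in a domain\<close>

lemma (in cring) vandermonde_value_closed: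
  "x \<in> {1..n} \<rightarrow> carrier R \<Longrightarrow> vandermonde_value R n x \<in> carrier R"
  unfolding vandermonde_value_eq using vandermonde_product_closed by (intro m_closed finprod_closed)

lemma (in ring_hom_cring) hom_vandermonde_value:
  assumes x: "x \<in> {1..n} \<rightarrow> carrier R" and y: "\<And>j. j \<in> {1..n} \<Longrightarrow> y j = h (x j)"
  shows "h (vandermonde_value R n x) = vandermonde_value S n y"
proof -
  let ?P = "{(j, k). 1 \<le> j \<and> j < k \<and> k \<le> n}"
  have xs: "x j \<in> carrier R" if "j \<in> {1..n}" for j using x that by auto
  have d: "(\<lambda>p. x (fst p) \<ominus> x (snd p)) \<in> ?P \<rightarrow> carrier R" using xs by auto
  have "h (\<Otimes>j\<in>{1..n}. x j) = (\<Otimes>\<^bsub>S\<^esub>j\<in>{1..n}. y j)"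
    unfolding hom_finprod[OF x] using xs y by (intro S.finprod_cong') auto
  moreover have "h (\<Otimes>p\<in>?P. x (fst p) \<ominus> x (snd p)) = (\<Otimes>\<^bsub>S\<^esub>p\<in>?P. y (fst p) \<ominus>\<^bsub>S\<^esub> y (snd p))"
    unfolding hom_finprod[OF d] using xs y by (intro S.finprod_cong') (auto simp: a_minus_def)
  ultimately show ?thesis
    unfolding vandermonde_value_def using x d by (simp add: R.finprod_closed)
qed

lemma (in domain) finprod_nonzero:
  assumes "finite A" "f \<in> A \<rightarrow> carrier R - {\<zero>}"
  shows "finprod R f A \<noteq> \<zero>"
  using assms
proof (induction A rule: finite_induct)
  case (insert i A)
  then have "f \<in> A \<rightarrow> carrier R" by auto
  then show ?case using insert by (auto simp: integral_iff)
qed auto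

lemma (in domain) vandermonde_value_nonzero:
  assumes x: "x \<in> {1..n} \<rightarrow> carrier R - {\<zero>}" and inj: "inj_on x {1..n}"
  shows "vandermonde_value R n x \<noteq> \<zero>"
proof -
  let ?P = "{(j, k). 1 \<le> j \<and> j < k \<and> k \<le> n}"
  have xs: "x j \<in> carrier R" if "j \<in> {1..n}" for j using x that by auto
  have d: "(\<lambda>p. x (fst p) \<ominus> x (snd p)) \<in> ?P \<rightarrow> carrier R - {\<zero>}"
  proof
    fix p assume "p \<in> ?P"
    then obtain j k where p: "p = (j, k)" "j \<in> {1..n}" "k \<in> {1..n}" "j \<noteq> k" by auto
    then have "x j \<noteq> x k" using inj by (auto dest: inj_onD)
    then show "x (fst p) \<ominus> x (snd p) \<in> carrier R - {\<zero>}" using xs p by simp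
  qed
  show ?thesis
    unfolding vandermonde_value_def
    using finprod_nonzero[OF _ x] finprod_nonzero[OF finite_ordered_pairs d] x d
    by (subst integral_iff) (auto intro!: finprod_closed)
qed

text \<open>Multiplication by \<open>x\<close> permutes \<open>X\<close>, so the product over \<open>X\<close> is unchanged by the factor
\<open>x [^] card X\<close>.\<close>

lemma (in domain) pow_card_eq_one:
  assumes X: "finite X" "X \<subseteq> carrier R - {\<zero>}" and mult: "\<And>y z. y \<in> X \<Longrightarrow> z \<in> X \<Longrightarrow> y \<otimes> z \<in> X"
    and x: "x \<in> X"
  shows "x [^] card X = \<one>"
proof -
  have xc: "x \<in> carrier R" "x \<noteq> \<zero>" using x X by auto
  have inj: "inj_on ((\<otimes>) x) X"
    using xc X by (auto simp: inj_on_def m_lcancel subset_iff)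
  have "(\<otimes>) x ` X = X" using mult x by (intro endo_inj_surj X(1) inj) auto
  then have "(\<Otimes>y\<in>X. y) = (\<Otimes>y\<in>(\<otimes>) x ` X. y)" by simp
  also have "\<dots> = (\<Otimes>y\<in>X. x \<otimes> y)"
    using xc X by (intro finprod_reindex inj) auto
  also have "\<dots> = (\<Otimes>y\<in>X. x) \<otimes> (\<Otimes>y\<in>X. y)"
    using xc X by (intro finprod_multf) auto
  also have "(\<Otimes>y\<in>X. x) = x [^] card X" by (rule finprod_const[OF xc(1)])
  finally have eq: "x [^] card X \<otimes> (\<Otimes>y\<in>X. y) = \<one> \<otimes> (\<Otimes>y\<in>X. y)"
    using X by (simp add: finprod_closed Pi_iff subset_iff)
  moreover have "(\<Otimes>y\<in>X. y) \<in> carrier R" using X by (intro finprod_closed) auto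
  moreover have "(\<Otimes>y\<in>X. y) \<noteq> \<zero>" using X by (intro finprod_nonzero) auto
  ultimately show ?thesis using xc(1) m_rcancel[of "\<Otimes>y\<in>X. y" "x [^] card X" \<one>] by blast
qed

text \<open>If the image of \<open>S\<close> had \<open>n\<close> distinct nonzero elements, \<open>p\<^sub>n\<close> would not vanish there.  So the nonzero
elements of the image are a finite multiplicatively closed set, and \<open>k\<close> is the number of all elements,
zero included.\<close>

lemma (in domain) subring_image_pow:
  fixes S (structure)
  assumes S: "cring S" and h: "h \<in> ring_hom S R"
    and vanish: "\<And>x. x \<in> vecs S n \<Longrightarrow> h (vandermonde_value S n x) = \<zero>"
  shows "\<exists>k. 2 \<le> k \<and> k \<le> n \<and> (\<forall>r\<in>carrier S. h (r [^]\<^bsub>S\<^esub> k) = h r)"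
proof -
  interpret S: cring S by (rule S)
  interpret h: ring_hom_cring S R h
    by (intro ring_hom_cring.intro ring_hom_cring_axioms.intro S cring_axioms h)
  define X where "X = h ` carrier S - {\<zero>}"
  have Xc: "X \<subseteq> carrier R - {\<zero>}" by (auto simp: X_def)
  have small: "\<not> (\<exists>Y\<subseteq>X. finite Y \<and> card Y = n)"
  proof
    assume "\<exists>Y\<subseteq>X. finite Y \<and> card Y = n"
    then obtain Y where Y: "Y \<subseteq> X" "finite Y" "card Y = n" by blast
    then obtain y where y: "bij_betw y {1..n} Y"
      using finite_same_card_bij[of "{1..n}" Y] by auto
    have "\<forall>j\<in>{1..n}. \<exists>r\<in>carrier S. h r = y j"
      using y Y(1) unfolding bij_betw_def X_def by fastforce
    then obtain x where x: "\<And>j. j \<in> {1..n} \<Longrightarrow> x j \<in> carrier S \<and> h (x j) = y j" by metis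
    have "restrict x {1..n} \<in> vecs S n" using x by (auto simp: vecs_def)
    moreover have "h (vandermonde_value S n (restrict x {1..n})) = vandermonde_value R n y"
      using x by (intro h.hom_vandermonde_value) auto
    moreover have "vandermonde_value R n y \<noteq> \<zero>"
      using y Y(1) Xc by (intro vandermonde_value_nonzero) (auto simp: bij_betw_def)
    ultimately show False using vanish by simp
  qed
  have fin: "finite X" using small infinite_arbitrarily_large by metis
  have less: "card X < n"
    using small obtain_subset_with_card_n[of n X] by (metis finite_subset fin not_le)
  have "\<one> \<in> X" unfolding X_def using h.hom_one one_not_zero S.one_closed
    by (metis DiffI imageI singletonD)
  then have pos: "card X \<noteq> 0" using fin by auto
  have mult: "y \<otimes> z \<in> X" if "y \<in> X" "z \<in> X" for y z
  proof -
    obtain r s where "r \<in> carrier S" "s \<in> carrier S" "y = h r" "z = h s"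
      using \<open>y \<in> X\<close> \<open>z \<in> X\<close> unfolding X_def by auto
    then have "y \<otimes> z \<in> h ` carrier S" by (metis h.hom_mult imageI S.m_closed)
    moreover have "y \<otimes> z \<noteq> \<zero>" using that Xc integral_iff[of y z] by blast
    ultimately show ?thesis unfolding X_def by simp
  qed
  have "h (r [^]\<^bsub>S\<^esub> Suc (card X)) = h r" if r: "r \<in> carrier S" for r
  proof (cases "h r = \<zero>")
    case True
    then show ?thesis using r by simp
  next
    case False
    then have "h r \<in> X" using r by (simp add: X_def)
    have pow: "h (r [^]\<^bsub>S\<^esub> k) = h r [^] (k::nat)" for k
      using r by (induction k) auto
    have "h r [^] card X = \<one>" using \<open>h r \<in> X\<close> by (intro pow_card_eq_one fin Xc mult)
    then show ?thesis using r by (simp add: pow)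
  qed
  then show ?thesis using less pos by (intro exI[of _ "Suc (card X)"]) auto
qed


section \<open>Rings whose total ring of fractions is Kasch\<close>

text \<open>Krull's theorem, by Zorn's lemma.\<close>

lemma (in ring) maximalideal_containing:
  assumes J: "ideal J R" "\<one> \<notin> J"
  shows "\<exists>M. maximalideal M R \<and> J \<subseteq> M"
proof -
  let ?A = "{I. ideal I R \<and> J \<subseteq> I \<and> \<one> \<notin> I}"
  have "\<exists>M\<in>?A. \<forall>X\<in>?A. M \<subseteq> X \<longrightarrow> X = M"
  proof (rule subset_Zorn_nonempty)
    show "?A \<noteq> {}" using J by blast
    fix C assume C: "C \<noteq> {}" "subset.chain ?A C"
    then have sub: "C \<subseteq> ?A" by (auto simp: pred_on.chain_def)
    have "subset.chain {I. ideal I R} C" using C(2) by (auto simp: pred_on.chain_def)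
    from chain_Union_is_ideal[OF this] have "ideal (\<Union>C) R" using C(1) by simp
    then show "\<Union>C \<in> ?A" using C(1) sub by blast
  qed
  then obtain M where "M \<in> ?A" and max: "\<forall>X\<in>?A. M \<subseteq> X \<longrightarrow> X = M" by (elim bexE)
  then have M: "ideal M R" "J \<subseteq> M" "\<one> \<notin> M" by simp_all
  have "maximalideal M R"
  proof (rule maximalidealI[OF M(1)])
    show "carrier R \<noteq> M" using M(3) by blast
    fix X assume X: "ideal X R" "M \<subseteq> X"
    show "X = M \<or> X = carrier R"
    proof (cases "\<one> \<in> X")
      case True
      then show ?thesis using ideal.one_imp_carrier[OF X(1)] by simp
    next
      case False
      then have "X \<in> ?A" using X M(2) by auto
      then show ?thesis using max X(2) by blast
    qed
  qed
  with M(2) show ?thesis by blast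
qed

lemma (in cring) fraction_eq_iff:
  assumes S: "S \<subseteq> carrier R" "\<one> \<in> S" "\<And>s t. s \<in> S \<Longrightarrow> t \<in> S \<Longrightarrow> s \<otimes> t \<in> S"
    and "a \<in> carrier R" "s \<in> S" "b \<in> carrier R" "t \<in> S"
  shows "fraction R S a s = fraction R S b t \<longleftrightarrow> (\<exists>u\<in>S. u \<otimes> (a \<otimes> t \<ominus> b \<otimes> s) = \<zero>)"
  unfolding fraction_def
  using eq_equiv_class_iff[OF equiv_loc_rel[OF S], of "(a, s)" "(b, t)"] assms(4-)
  by (auto simp: loc_rel_def)

lemma (in cring) nonzerodivisor_cancel:
  "u \<in> carrier R - zerodivisors R \<Longrightarrow> x \<in> carrier R \<Longrightarrow> u \<otimes> x = \<zero> \<Longrightarrow> x = \<zero>"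
  unfolding zerodivisors_def by auto

text \<open>The witness \<open>b\<close> is the numerator of a fraction that annihilates a maximal ideal \<open>M\<close> of the total ring
of fractions, chosen to contain the annihilator of \<open>a\<close> and thereby all values of \<open>p\<^sub>n\<close>.\<close>

lemma (in cring) Q_kasch_powers_agree:
  assumes kasch: "kasch (total_fractions R)"
    and a: "a \<in> carrier R" "a \<noteq> \<zero>"
    and vanish: "\<And>x. x \<in> vecs R n \<Longrightarrow> a \<otimes> vandermonde_value R n x = \<zero>"
  shows "\<exists>b\<in>carrier R. b \<noteq> \<zero> \<and> (\<exists>k. 2 \<le> k \<and> k \<le> n \<and> (\<forall>r\<in>carrier R. b \<otimes> r [^] k = b \<otimes> r))"
proof -
  define S where "S = carrier R - zerodivisors R"
  define Q where "Q = total_fractions R"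
  have Q_loc: "Q = localization R S" by (simp add: Q_def S_def total_fractions_def)
  have cancel: "x = \<zero>" if "u \<in> S" "x \<in> carrier R" "u \<otimes> x = \<zero>" for u x
    using that nonzerodivisor_cancel unfolding S_def by blast
  have Sc: "S \<subseteq> carrier R" by (auto simp: S_def)
  have S1: "\<one> \<in> S" by (auto simp: S_def zerodivisors_def)
  have Smult: "s \<otimes> t \<in> S" if st: "s \<in> S" "t \<in> S" for s t
  proof -
    have regular: "b = \<zero>" if b: "b \<in> carrier R" "s \<otimes> t \<otimes> b = \<zero>" for b
    proof -
      have "s \<otimes> (t \<otimes> b) = \<zero>" using b st Sc by (simp add: m_assoc subset_iff)
      then show ?thesis using cancel st b Sc by blast
    qed
    have "s \<otimes> t \<in> carrier R" using st Sc by auto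
    then show ?thesis unfolding S_def zerodivisors_def using regular by blast
  qed
  have Sc': "s \<in> carrier R" if "s \<in> S" for s using that Sc by blast
  interpret Q: cring Q unfolding Q_def by (rule total_fractions_cring)
  note ops = localization_ops[OF Sc S1 Smult, folded Q_loc]
  have carr: "carrier Q = {fraction R S x s | x s. x \<in> carrier R \<and> s \<in> S}"
    unfolding Q_loc localization_def fraction_def quotient_def by auto
  have Q_cl: "fraction R S x s \<in> carrier Q" if "x \<in> carrier R" "s \<in> S" for x s
    using that unfolding carr by blast
  have Q1: "\<one>\<^bsub>Q\<^esub> = fraction R S \<one> \<one>" and Q0: "\<zero>\<^bsub>Q\<^esub> = fraction R S \<zero> \<one>"
    by (simp_all add: Q_loc localization_def)
  have zero_iff: "fraction R S x s = \<zero>\<^bsub>Q\<^esub> \<longleftrightarrow> x = \<zero>" if x: "x \<in> carrier R" "s \<in> S" for x s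
  proof -
    have "fraction R S x s = fraction R S \<zero> \<one> \<longleftrightarrow> (\<exists>u\<in>S. u \<otimes> (x \<otimes> \<one> \<ominus> \<zero> \<otimes> s) = \<zero>)"
      using x S1 by (intro fraction_eq_iff[OF Sc S1 Smult]) auto
    also have "x \<otimes> \<one> \<ominus> \<zero> \<otimes> s = x" using x(1) Sc'[OF x(2)] by (simp add: minus_eq)
    also have "(\<exists>u\<in>S. u \<otimes> x = \<zero>) \<longleftrightarrow> x = \<zero>"
    proof
      assume "\<exists>u\<in>S. u \<otimes> x = \<zero>"
      then show "x = \<zero>" using cancel x(1) by blast
    next
      assume "x = \<zero>"
      then have "\<one> \<otimes> x = \<zero>" by simp
      then show "\<exists>u\<in>S. u \<otimes> x = \<zero>" using S1 by blast
    qed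
    finally show ?thesis unfolding Q0 .
  qed
  \<comment> \<open>Below, \<open>J\<close> is the extension to \<open>Q\<close> of the annihilator of \<open>a\<close>.  It is proper, because a
    non-zerodivisor does not annihilate \<open>a\<close>.\<close>
  define i where "i r = fraction R S r \<one>" for r
  have i: "i \<in> ring_hom R Q"
    by (rule ring_hom_memI) (simp_all add: i_def Q_cl S1 ops Q1)
  define J where "J = {fraction R S x s | x s. x \<in> carrier R \<and> a \<otimes> x = \<zero> \<and> s \<in> S}"
  have JI: "fraction R S x s \<in> J" if "x \<in> carrier R" "a \<otimes> x = \<zero>" "s \<in> S" for x s
    using that unfolding J_def by blast
  have J_mult: "y \<otimes>\<^bsub>Q\<^esub> z \<in> J" if y: "y \<in> carrier Q" and z: "z \<in> J" for y z
  proof -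
    obtain x s w t where x: "x \<in> carrier R" "s \<in> S" "y = fraction R S x s"
      "w \<in> carrier R" "a \<otimes> w = \<zero>" "t \<in> S" "z = fraction R S w t"
      using y z unfolding carr J_def by blast
    have "a \<otimes> (x \<otimes> w) = x \<otimes> (a \<otimes> w)" using a(1) x(1,4) by (simp add: m_lcomm)
    then show ?thesis using x Smult by (auto simp: ops intro!: JI)
  qed
  have J_sub: "J \<subseteq> carrier Q" unfolding J_def carr by blast
  have J: "ideal J Q"
  proof (rule idealI)
    show "ring Q" ..
    show "subgroup J (add_monoid Q)"
    proof (rule Q.add.subgroupI)
      show "J \<subseteq> carrier Q" by (rule J_sub)
      show "J \<noteq> {}" using JI[of \<zero> \<one>] a(1) S1 by auto
      fix y assume y: "y \<in> J"
      have "\<ominus>\<^bsub>Q\<^esub> y = (\<ominus>\<^bsub>Q\<^esub> \<one>\<^bsub>Q\<^esub>) \<otimes>\<^bsub>Q\<^esub> y"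
        using y J_sub by (simp add: Q.l_minus subset_iff)
      then show "\<ominus>\<^bsub>Q\<^esub> y \<in> J" using J_mult[OF _ y] by simp
      fix z assume z: "z \<in> J"
      obtain x s w t where x: "x \<in> carrier R" "a \<otimes> x = \<zero>" "s \<in> S" "y = fraction R S x s"
        "w \<in> carrier R" "a \<otimes> w = \<zero>" "t \<in> S" "z = fraction R S w t"
        using y z unfolding J_def by blast
      have "a \<otimes> (x \<otimes> t \<oplus> w \<otimes> s) = t \<otimes> (a \<otimes> x) \<oplus> s \<otimes> (a \<otimes> w)"
        using a(1) x(1,5) Sc'[OF x(3)] Sc'[OF x(7)] by algebra
      then have "a \<otimes> (x \<otimes> t \<oplus> w \<otimes> s) = \<zero>" using x Sc' by simp
      then show "y \<oplus>\<^bsub>Q\<^esub> z \<in> J" using x Sc' Smult by (auto simp: ops intro!: JI)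
    qed
    fix y z assume "y \<in> J" "z \<in> carrier Q"
    then show "z \<otimes>\<^bsub>Q\<^esub> y \<in> J" "y \<otimes>\<^bsub>Q\<^esub> z \<in> J"
      using J_mult J_sub Q.m_comm[of y z] by auto
  qed
  have "\<one>\<^bsub>Q\<^esub> \<notin> J"
  proof
    assume "\<one>\<^bsub>Q\<^esub> \<in> J"
    then obtain x s where x: "x \<in> carrier R" "a \<otimes> x = \<zero>" "s \<in> S" "fraction R S \<one> \<one> = fraction R S x s"
      unfolding J_def Q1 by blast
    then obtain u where u: "u \<in> S" "u \<otimes> (\<one> \<otimes> s \<ominus> x \<otimes> \<one>) = \<zero>"
      using S1 by (subst (asm) fraction_eq_iff[OF Sc S1 Smult]) auto
    then have "s \<ominus> x = \<zero>" using cancel[OF u(1), of "s \<ominus> x"] x(1) Sc'[OF x(3)] by simp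
    then have "s = x" using x(1) Sc'[OF x(3)] by simp
    then have "s \<otimes> a = \<zero>" using x(1,2) a(1) by (simp add: m_comm)
    then show False using cancel[OF x(3) a(1)] a(2) by blast
  qed
  then obtain M where M: "maximalideal M Q" "J \<subseteq> M" using Q.maximalideal_containing[OF J] by blast
  interpret M: maximalideal M Q by (rule M(1))
  have "\<zero>\<^bsub>Q\<^esub> \<in> annihilator Q M" using M.Icarr by (auto simp: annihilator_def)
  moreover have "annihilator Q M \<noteq> {\<zero>\<^bsub>Q\<^esub>}" using kasch M(1) unfolding kasch_def Q_def by blast
  ultimately obtain q where q: "q \<in> carrier Q" "q \<noteq> \<zero>\<^bsub>Q\<^esub>" "\<And>y. y \<in> M \<Longrightarrow> q \<otimes>\<^bsub>Q\<^esub> y = \<zero>\<^bsub>Q\<^esub>"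
    unfolding annihilator_def by auto
  obtain b s where b: "b \<in> carrier R" "s \<in> S" "q = fraction R S b s" using q(1) unfolding carr by blast
  have b0: "b \<noteq> \<zero>" using q(2) zero_iff[OF b(1,2)] b(3) by blast
  have kill: "b \<otimes> r = \<zero>" if r: "r \<in> carrier R" "i r \<in> M" for r
  proof -
    have "fraction R S (b \<otimes> r) (s \<otimes> \<one>) = \<zero>\<^bsub>Q\<^esub>"
      using q(3)[OF r(2)] b r(1) S1 by (simp add: i_def ops)
    then show ?thesis using zero_iff b r(1) S1 Sc' by simp
  qed
  have prime: "primeideal M Q" by (rule Q.maximalideal_prime[OF M(1)])
  interpret D: domain "Q Quot M" by (rule primeideal.quotient_is_domain[OF prime])
  \<comment> \<open>The image of \<open>R\<close> in the residue field, where all values of \<open>p\<^sub>n\<close> vanish.\<close>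
  define h where "h = (+>\<^bsub>Q\<^esub>) M \<circ> i"
  have h: "h \<in> ring_hom R (Q Quot M)"
    unfolding h_def by (rule ring_hom_trans[OF i M.rcos_ring_hom])
  interpret h: ring_hom_cring R "Q Quot M" h
    by (intro ring_hom_cring.intro ring_hom_cring_axioms.intro cring_axioms D.cring_axioms h)
  have D0: "\<zero>\<^bsub>Q Quot M\<^esub> = M" by (simp add: FactRing_def)
  have h_zero: "i r \<in> M" if "r \<in> carrier R" "h r = \<zero>\<^bsub>Q Quot M\<^esub>" for r
    using that M.rcos_const_imp_mem ring_hom_closed[OF i] unfolding D0 h_def by auto
  have "h (vandermonde_value R n x) = \<zero>\<^bsub>Q Quot M\<^esub>" if x: "x \<in> vecs R n" for x
  proof -
    have "vandermonde_value R n x \<in> carrier R"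
      using x by (intro vandermonde_value_closed) (auto simp: vecs_def)
    then have "i (vandermonde_value R n x) \<in> M"
      using JI vanish[OF x] S1 M(2) unfolding i_def by blast
    then show ?thesis unfolding D0 h_def comp_def by (rule Q.a_rcos_zero[OF M.ideal_axioms])
  qed
  then obtain k where k: "2 \<le> k" "k \<le> n" "\<And>r. r \<in> carrier R \<Longrightarrow> h (r [^] k) = h r"
    using D.subring_image_pow[OF cring_axioms h, of n] by blast
  have "b \<otimes> r [^] k = b \<otimes> r" if r: "r \<in> carrier R" for r
  proof -
    have "h (r [^] k \<ominus> r) = \<zero>\<^bsub>Q Quot M\<^esub>"
      using k(3)[OF r] r by (simp add: minus_eq a_minus_def D.r_neg)
    then have "b \<otimes> (r [^] k \<ominus> r) = \<zero>" using r by (intro kill h_zero) auto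
    then have "b \<otimes> r [^] k \<ominus> b \<otimes> r = \<zero>"
      using b(1) r by (simp add: r_distr r_minus minus_eq)
    then show ?thesis using b(1) r by simp
  qed
  then show ?thesis using b(1) b0 k(1,2) by blast
qed

text \<open>A nonzero annihilator of the values of \<open>p\<^sub>n\<close> has a nonzero component, and in that factor it still
annihilates all values because the projection is surjective.  The element found in the factor is then
extended by zero to the product.\<close>

lemma (in cring) product_of_Q_kasch_powers_agree:
  fixes idx_type :: "'idx itself" and elt_type :: "'elt itself"
  assumes prod: "product_of_Q_kasch idx_type elt_type R" and nfull: "\<not> vandermonde_full R n"
  shows "\<exists>b\<in>carrier R. b \<noteq> \<zero> \<and> (\<exists>k. 2 \<le> k \<and> k \<le> n \<and> (\<forall>r\<in>carrier R. b \<otimes> r [^] k = b \<otimes> r))"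
proof -
  obtain a where a: "a \<in> carrier R" "a \<noteq> \<zero>" "\<And>x. x \<in> vecs R n \<Longrightarrow> a \<otimes> vandermonde_value R n x = \<zero>"
    using nfull unfolding vandermonde_full_iff by blast
  obtain I :: "'idx set" and S :: "'idx \<Rightarrow> 'elt ring" and h
    where S: "\<And>i. i \<in> I \<Longrightarrow> cring (S i)" "\<And>i. i \<in> I \<Longrightarrow> kasch (total_fractions (S i))"
      and iso: "h \<in> ring_iso R (product_ring I S)"
    using prod unfolding product_of_Q_kasch_def is_ring_iso_def by blast
  have bij: "bij_betw h (carrier R) (\<Pi>\<^sub>E i\<in>I. carrier (S i))"
    using ring_iso_memE(5)[OF iso] by (simp add: product_ring_def)
  have hE: "h x \<in> (\<Pi>\<^sub>E i\<in>I. carrier (S i))" if "x \<in> carrier R" for x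
    using bij that by (rule bij_betw_apply)
  have hinj: "x = y" if "x \<in> carrier R" "y \<in> carrier R" "\<And>i. i \<in> I \<Longrightarrow> h x i = h y i" for x y
  proof -
    have "h x = h y" using hE[OF that(1)] hE[OF that(2)] that(3) by (rule PiE_ext)
    then show ?thesis using bij that by (auto simp: bij_betw_def dest: inj_onD)
  qed
  have hc: "h x i \<in> carrier (S i)" if "x \<in> carrier R" "i \<in> I" for x i
    using hE[OF that(1)] that(2) by (rule PiE_mem)
  have hom: "(\<lambda>x. h x i) \<in> ring_hom R (S i)" if i: "i \<in> I" for i
    using i ring_iso_memE(2,3,4)[OF iso] hc
    by (intro ring_hom_memI) (simp_all add: product_ring_def)
  have hom_cring: "ring_hom_cring R (S i) (\<lambda>x. h x i)" if "i \<in> I" for i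
    using that
    by (intro ring_hom_cring.intro ring_hom_cring_axioms.intro cring_axioms S(1) hom)
  obtain i where i: "i \<in> I" "h a i \<noteq> h \<zero> i" using hinj[of a \<zero>] a by auto
  interpret p: ring_hom_cring R "S i" "\<lambda>x. h x i" by (rule hom_cring[OF i(1)])
  define emb where "emb y = inv_into (carrier R) h (\<lambda>l\<in>I. if l = i then y else \<zero>\<^bsub>S l\<^esub>)" for y
  have emb: "emb y \<in> carrier R" "\<And>l. l \<in> I \<Longrightarrow> h (emb y) l = (if l = i then y else \<zero>\<^bsub>S l\<^esub>)"
    if y: "y \<in> carrier (S i)" for y
  proof -
    let ?v = "\<lambda>l\<in>I. if l = i then y else \<zero>\<^bsub>S l\<^esub>"
    have zero: "\<zero>\<^bsub>S l\<^esub> \<in> carrier (S l)" if "l \<in> I" for l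
      using S(1)[OF that] by (simp add: cring.cring_simprules(2))
    have "?v \<in> (\<Pi>\<^sub>E i\<in>I. carrier (S i))" using y zero by auto
    then have v: "?v \<in> h ` carrier R" using bij by (simp add: bij_betw_def)
    show "emb y \<in> carrier R" unfolding emb_def by (rule inv_into_into[OF v])
    show "h (emb y) l = (if l = i then y else \<zero>\<^bsub>S l\<^esub>)" if "l \<in> I" for l
      unfolding emb_def f_inv_into_f[OF v] using that by simp
  qed
  have "h a i \<otimes>\<^bsub>S i\<^esub> vandermonde_value (S i) n y = \<zero>\<^bsub>S i\<^esub>" if y: "y \<in> vecs (S i) n" for y
  proof -
    define x where "x = (\<lambda>j\<in>{1..n}. emb (y j))"
    have yc: "y j \<in> carrier (S i)" if "j \<in> {1..n}" for j using y that by (auto simp: vecs_def)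
    have x: "x \<in> vecs R n" using emb(1) yc by (auto simp: x_def vecs_def)
    then have xc: "x \<in> {1..n} \<rightarrow> carrier R" by (auto simp: vecs_def)
    have "h (vandermonde_value R n x) i = vandermonde_value (S i) n y"
      using xc emb(2)[OF yc i(1)] by (intro p.hom_vandermonde_value) (auto simp: x_def)
    then show ?thesis
      using p.hom_mult[OF a(1) vandermonde_value_closed[OF xc]] a(3)[OF x] by simp
  qed
  then obtain c k where c: "c \<in> carrier (S i)" "c \<noteq> \<zero>\<^bsub>S i\<^esub>" "2 \<le> k" "k \<le> n"
    "\<And>r. r \<in> carrier (S i) \<Longrightarrow> c \<otimes>\<^bsub>S i\<^esub> r [^]\<^bsub>S i\<^esub> k = c \<otimes>\<^bsub>S i\<^esub> r"
    using cring.Q_kasch_powers_agree[OF S(1)[OF i(1)] S(2)[OF i(1)], of "h a i" n] a(1) i(2)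
    by auto
  have "emb c \<noteq> \<zero>" using emb(2)[OF c(1) i(1)] c(2) by auto
  moreover have "emb c \<otimes> r [^] k = emb c \<otimes> r" if r: "r \<in> carrier R" for r
  proof (rule hinj)
    fix l assume l: "l \<in> I"
    interpret q: ring_hom_cring R "S l" "\<lambda>x. h x l" by (rule hom_cring[OF l])
    have pow: "h (r [^] k) l = h r l [^]\<^bsub>S l\<^esub> k" for k :: nat
      using r by (induction k) auto
    show "h (emb c \<otimes> r [^] k) l = h (emb c \<otimes> r) l"
      using emb[OF c(1)] l r c(5)[of "h r i"] by (auto simp: pow)
  qed (use r emb(1)[OF c(1)] in auto)
  ultimately show ?thesis using emb(1)[OF c(1)] c(3,4) by blast
qed


section \<open>Homogeneous parts of multi-affine maps\<close>

context cring
begin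

definition indicator_vec :: "nat \<Rightarrow> nat set \<Rightarrow> nat \<Rightarrow> 'a" where
  "indicator_vec n A = (\<lambda>j\<in>{1..n}. if j \<in> A then \<one> else \<zero>)"

lemma vecs_closed: "x \<in> vecs R n \<Longrightarrow> x \<in> {1..n} \<rightarrow> carrier R"
  by (auto simp: vecs_def)

lemma indicator_vec_in_vecs: "indicator_vec n A \<in> vecs R n"
  by (simp add: indicator_vec_def vecs_def)

lemma zero_vec_in_vecs: "zero_vec R n \<in> vecs R n"
  by (simp add: zero_vec_def vecs_def)

lemma scale_vec_in_vecs: "r \<in> carrier R \<Longrightarrow> v \<in> vecs R n \<Longrightarrow> scale_vec R n r v \<in> vecs R n"
  by (auto simp: scale_vec_def vecs_def)

lemma scale_vec_zero: "v \<in> vecs R n \<Longrightarrow> scale_vec R n \<zero> v = zero_vec R n"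
  unfolding scale_vec_def zero_vec_def by (rule restrict_ext) (auto simp: vecs_def PiE_iff)

lemma ballot_direction_eq_indicator_vec: "ballot_direction R n B = indicator_vec n ({1..n} - B)"
  by (auto simp: ballot_direction_def indicator_vec_def)

lemma ballot_directions_subset_vecs: "ballot_directions R n \<subseteq> vecs R n"
  by (auto simp: ballot_directions_def ballot_direction_eq_indicator_vec indicator_vec_in_vecs)

lemma card_ballot_directions:
  assumes "\<one> \<noteq> \<zero>"
  shows "card (ballot_directions R n) = n choose (n div 2)"
proof -
  have "inj_on (ballot_direction R n) {B. ballot_set n B}"
  proof (rule inj_on_inverseI)
    fix B assume "B \<in> {B. ballot_set n B}"
    then have "B \<subseteq> {1..n}" using ballot_set_subset by blast
    then show "{j \<in> {1..n}. ballot_direction R n B j = \<zero>} = B"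
      using assms by (auto simp: ballot_direction_def)
  qed
  then show ?thesis
    unfolding ballot_directions_def by (simp add: card_image card_ballot_sets)
qed

text \<open>The homogeneous part of degree \<open>k\<close> of the multi-affine map with coefficients \<open>a\<close>.\<close>

definition hom_part :: "nat \<Rightarrow> (nat set \<Rightarrow> 'a) \<Rightarrow> nat \<Rightarrow> (nat \<Rightarrow> 'a) \<Rightarrow> 'a" where
  "hom_part n a k x = (\<Oplus>J\<in>ksubsets {1..n} k. a J \<otimes> (\<Otimes>j\<in>J. x j))"

lemma monomial_closed:
  "x \<in> vecs R n \<Longrightarrow> J \<in> ksubsets {1..n} k \<Longrightarrow> (\<Otimes>j\<in>J. x j) \<in> carrier R"
  by (rule finprod_closed) (auto simp: vecs_def ksubsets_def)

lemma hom_part_closed: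
  "a \<in> ksubsets {1..n} k \<rightarrow> carrier R \<Longrightarrow> x \<in> vecs R n \<Longrightarrow> hom_part n a k x \<in> carrier R"
  unfolding hom_part_def using monomial_closed by (intro finsum_closed) (auto simp: Pi_iff)

lemma hom_part_scale:
  assumes a: "a \<in> ksubsets {1..n} k \<rightarrow> carrier R" and r: "r \<in> carrier R" and v: "v \<in> vecs R n"
  shows "hom_part n a k (scale_vec R n r v) = r [^] k \<otimes> hom_part n a k v"
proof -
  have "hom_part n a k (scale_vec R n r v) =
      (\<Oplus>J\<in>ksubsets {1..n} k. r [^] k \<otimes> (a J \<otimes> (\<Otimes>j\<in>J. v j)))"
    unfolding hom_part_def
  proof (rule finsum_cong')
    fix J assume J: "J \<in> ksubsets {1..n} k"
    then have sub: "J \<subseteq> {1..n}" "card J = k" by (auto simp: ksubsets_def)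
    then have vJ: "v \<in> J \<rightarrow> carrier R" using v by (auto simp: vecs_def)
    have "(\<Otimes>j\<in>J. scale_vec R n r v j) = (\<Otimes>j\<in>J. r \<otimes> v j)"
      using sub vJ r by (intro finprod_cong') (auto simp: scale_vec_def)
    also have "\<dots> = (\<Otimes>j\<in>J. r) \<otimes> (\<Otimes>j\<in>J. v j)" using vJ r by (intro finprod_multf) auto
    also have "(\<Otimes>j\<in>J. r) = r [^] k" unfolding sub(2)[symmetric] by (rule finprod_const[OF r])
    finally show "a J \<otimes> (\<Otimes>j\<in>J. scale_vec R n r v j) = r [^] k \<otimes> (a J \<otimes> (\<Otimes>j\<in>J. v j))"
      using a J r monomial_closed[OF v J] by (simp add: m_lcomm Pi_iff)
  qed (use a r monomial_closed[OF v] in \<open>auto simp: Pi_iff\<close>)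
  also have "\<dots> = r [^] k \<otimes> hom_part n a k v"
    unfolding hom_part_def using a r monomial_closed[OF v]
    by (intro finsum_rdistr[symmetric]) (auto simp: finite_ksubsets Pi_iff)
  finally show ?thesis .
qed

lemma hom_part_zero_vec:
  assumes "a \<in> ksubsets {1..n} k \<rightarrow> carrier R" "0 < k"
  shows "hom_part n a k (zero_vec R n) = \<zero>"
proof -
  have "hom_part n a k (scale_vec R n \<zero> (zero_vec R n)) = \<zero> [^] k \<otimes> hom_part n a k (zero_vec R n)"
    by (rule hom_part_scale[OF assms(1) zero_closed zero_vec_in_vecs])
  then show ?thesis
    using assms hom_part_closed[OF assms(1) zero_vec_in_vecs]
    by (simp add: scale_vec_zero zero_vec_in_vecs nat_pow_zero)
qed

text \<open>At a vector with entries \<open>0\<close> and \<open>1\<close>, exactly the monomials supported in \<open>A\<close> survive.\<close>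

lemma hom_part_indicator_vec:
  assumes a: "a \<in> ksubsets {1..n} k \<rightarrow> carrier R" and A: "A \<subseteq> {1..n}"
  shows "hom_part n a k (indicator_vec n A) = (\<Oplus>J\<in>ksubsets A k. a J)"
proof -
  have mono: "(\<Otimes>j\<in>J. indicator_vec n A j) = (if J \<subseteq> A then \<one> else \<zero>)" if J: "J \<subseteq> {1..n}" for J
  proof (cases "J \<subseteq> A")
    case True
    then have "(\<Otimes>j\<in>J. indicator_vec n A j) = \<one>"
      using J by (intro finprod_one_eqI) (auto simp: indicator_vec_def)
    then show ?thesis using True by simp
  next
    case False
    then obtain i where i: "i \<in> J" "i \<notin> A" by blast
    have "finite J" using J by (rule finite_subset) simp
    then have "(\<one> \<otimes> (\<Otimes>j\<in>J. indicator_vec n A j)) \<otimes> \<one> = \<zero>"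
      using i J by (intro finprod_annihilates[of _ i]) (auto simp: indicator_vec_def)
    moreover have "(\<Otimes>j\<in>J. indicator_vec n A j) \<in> carrier R"
      using J by (intro finprod_closed) (auto simp: indicator_vec_def)
    ultimately show ?thesis using False by simp
  qed
  show ?thesis
    unfolding hom_part_def
  proof (rule add.finprod_mono_neutral_cong_right)
    fix J assume "J \<in> ksubsets {1..n} k - ksubsets A k"
    then show "a J \<otimes> (\<Otimes>j\<in>J. indicator_vec n A j) = \<zero>"
      using mono a unfolding ksubsets_def by (auto simp: Pi_iff)
  next
    fix J assume "J \<in> ksubsets A k"
    then have "J \<in> ksubsets {1..n} k" "J \<subseteq> A" using A by (auto simp: ksubsets_def)
    then show "a J \<otimes> (\<Otimes>j\<in>J. indicator_vec n A j) = a J"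
      using mono[of J] a unfolding ksubsets_def by (auto simp: Pi_iff)
  qed (use a A monomial_closed[OF indicator_vec_in_vecs] in
      \<open>auto simp: finite_ksubsets intro: subsetD[OF ksubsets_mono]\<close>)
qed

lemma multi_affine_iff_hom_parts:
  "multi_affine R n f \<longleftrightarrow> (\<exists>a\<in>Pow {1..n} \<rightarrow> carrier R. \<forall>x\<in>vecs R n. f x = (\<Oplus>k\<in>{..n}. hom_part n a k x))"
proof -
  have eq: "(\<Oplus>J\<in>Pow {1..n}. a J \<otimes> (\<Otimes>j\<in>J. x j)) = (\<Oplus>k\<in>{..n}. hom_part n a k x)"
    if a: "a \<in> Pow {1..n} \<rightarrow> carrier R" and x: "x \<in> vecs R n" for a x
    unfolding Pow_eq_Union_ksubsets hom_part_def
  proof (rule add.finprod_UN_disjoint)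
    show "pairwise (\<lambda>i j. disjnt (ksubsets {1..n} i) (ksubsets {1..n} j)) {..n}"
      by (auto simp: pairwise_def disjnt_def ksubsets_def)
    fix k J assume J: "J \<in> ksubsets {1..n} k"
    then have "a J \<in> carrier R" using a by (auto simp: ksubsets_def)
    then show "a J \<otimes> (\<Otimes>j\<in>J. x j) \<in> carrier R" using monomial_closed[OF x J] by simp
  qed (auto simp: finite_ksubsets)
  show ?thesis unfolding multi_affine_def by (intro bex_cong ball_cong refl) (simp only: eq)
qed

lemma coefficients_on_ksubsets:
  "a \<in> Pow {1..n} \<rightarrow> carrier R \<Longrightarrow> a \<in> ksubsets {1..n} k \<rightarrow> carrier R"
  by (auto simp: ksubsets_def)

lemma hom_part_multi_affine:
  assumes a: "a \<in> ksubsets {1..n} k \<rightarrow> carrier R"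
  shows "multi_affine R n (hom_part n a k)"
proof -
  define b where "b J = (if J \<in> ksubsets {1..n} k then a J else \<zero>)" for J
  have b: "b \<in> Pow {1..n} \<rightarrow> carrier R" using a by (auto simp: b_def)
  have "hom_part n a k x = (\<Oplus>J\<in>Pow {1..n}. b J \<otimes> (\<Otimes>j\<in>J. x j))" if x: "x \<in> vecs R n" for x
    unfolding hom_part_def
  proof (rule add.finprod_mono_neutral_cong_left)
    have mono: "(\<Otimes>j\<in>J. x j) \<in> carrier R" if "J \<in> Pow {1..n}" for J
      using monomial_closed[OF x, of J "card J"] that by (simp add: ksubsets_def)
    then show "b J \<otimes> (\<Otimes>j\<in>J. x j) = \<zero>" if "J \<in> Pow {1..n} - ksubsets {1..n} k" for J
      using that by (auto simp: b_def)
    show "(\<lambda>J. b J \<otimes> (\<Otimes>j\<in>J. x j)) \<in> Pow {1..n} \<rightarrow> carrier R"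
      using b mono by blast
  qed (auto simp: b_def ksubsets_def)
  then show ?thesis unfolding multi_affine_def using b by blast
qed

lemma hom_part_affine_linear_on_line:
  assumes a: "a \<in> ksubsets {1..n} k \<rightarrow> carrier R" and "0 < k" and v: "v \<in> vecs R n"
    and "\<And>r. r \<in> carrier R \<Longrightarrow> r [^] k \<otimes> hom_part n a k v = r \<otimes> hom_part n a k v"
  shows "affine_linear_on_line R n (hom_part n a k) v"
  unfolding affine_linear_on_line_def
  using assms hom_part_closed[OF a v]
  by (intro bexI[of _ "hom_part n a k v"]) (auto simp: hom_part_scale hom_part_zero_vec)

text \<open>The vectors of the standard basis force the linear coefficients to vanish, as monomials of degree at
least \<open>2\<close> are zero there, whereas the indicator vector of \<open>J\<close> picks out the coefficient \<open>a J\<close>.\<close>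

lemma hom_part_not_affine_linear:
  assumes a: "a \<in> ksubsets {1..n} k \<rightarrow> carrier R" and k: "2 \<le> k"
    and J: "J \<in> ksubsets {1..n} k" "a J \<noteq> \<zero>"
  shows "\<not> affine_linear R n (hom_part n a k)"
proof
  assume "affine_linear R n (hom_part n a k)"
  then obtain c where c: "c \<in> {1..n} \<rightarrow> carrier R"
    and lin: "\<And>x. x \<in> vecs R n \<Longrightarrow> hom_part n a k x = hom_part n a k (zero_vec R n) \<oplus> (\<Oplus>i\<in>{1..n}. c i \<otimes> x i)"
    unfolding affine_linear_def by blast
  have cl: "(\<lambda>i. c i \<otimes> indicator_vec n A i) \<in> {1..n} \<rightarrow> carrier R" for A
    using c by (auto simp: indicator_vec_def Pi_iff)
  have eval: "(\<Oplus>J\<in>ksubsets A k. a J) = (\<Oplus>i\<in>{1..n}. c i \<otimes> indicator_vec n A i)"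
    if "A \<subseteq> {1..n}" for A
  proof -
    have "(\<Oplus>J\<in>ksubsets A k. a J) = hom_part n a k (indicator_vec n A)"
      by (rule hom_part_indicator_vec[OF a that, symmetric])
    also have "\<dots> = hom_part n a k (zero_vec R n) \<oplus> (\<Oplus>i\<in>{1..n}. c i \<otimes> indicator_vec n A i)"
      by (rule lin[OF indicator_vec_in_vecs])
    also have "hom_part n a k (zero_vec R n) = \<zero>" using k by (intro hom_part_zero_vec[OF a]) simp
    also have "\<zero> \<oplus> (\<Oplus>i\<in>{1..n}. c i \<otimes> indicator_vec n A i) =
        (\<Oplus>i\<in>{1..n}. c i \<otimes> indicator_vec n A i)" by (rule l_zero) (rule finsum_closed[OF cl])
    finally show ?thesis .
  qed
  have c0: "c i = \<zero>" if i: "i \<in> {1..n}" for i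
  proof -
    have "ksubsets {i} k = {}"
      using k by (auto simp: ksubsets_def subset_singleton_iff)
    moreover have "(\<Oplus>l\<in>{1..n}. c l \<otimes> indicator_vec n {i} l) = (\<Oplus>l\<in>{1..n}. if i = l then c l else \<zero>)"
      using c by (intro finsum_cong') (auto simp: indicator_vec_def Pi_iff)
    moreover have "\<dots> = c i" using i c by (intro finsum_singleton) auto
    ultimately show ?thesis using eval[of "{i}"] i by simp
  qed
  have sub: "J \<subseteq> {1..n}" "card J = k" using J(1) by (auto simp: ksubsets_def)
  have "finite J" using sub(1) by (rule finite_subset) simp
  then have "I = J" if "I \<in> ksubsets J k" for I
    using that sub(2) by (simp add: ksubsets_def card_subset_eq)
  moreover have "J \<in> ksubsets J k" using sub(2) by (simp add: ksubsets_def)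
  ultimately have "ksubsets J k = {J}" by blast
  moreover have "(\<Oplus>i\<in>{1..n}. c i \<otimes> indicator_vec n J i) = \<zero>"
    using c0 by (intro add.finprod_one_eqI) (auto simp: indicator_vec_def)
  moreover have "a J \<in> carrier R" using a J(1) by auto
  ultimately show False using eval[OF sub(1)] J(2) by simp
qed

lemma finsum_powers_eq_horner:
  assumes "L \<in> {..n} \<rightarrow> carrier R" "r \<in> carrier R"
  shows "(\<Oplus>k\<in>{..n}. r [^] k \<otimes> L k) = horner (map L [0..<Suc n]) r"
  using assms(1)
proof (induction n arbitrary: L)
  case 0
  then show ?case using assms(2) by (simp add: finsum_0)
next
  case (Suc n)
  have L: "L k \<in> carrier R" if "k \<le> Suc n" for k using Suc.prems that by auto
  have "(\<Oplus>k\<in>{..Suc n}. r [^] k \<otimes> L k) = (\<Oplus>k\<in>{..n}. r [^] Suc k \<otimes> L (Suc k)) \<oplus> r [^] (0::nat) \<otimes> L 0"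
    using L assms(2) by (intro finsum_Suc2) auto
  also have "(\<Oplus>k\<in>{..n}. r [^] Suc k \<otimes> L (Suc k)) = (\<Oplus>k\<in>{..n}. r \<otimes> (r [^] k \<otimes> L (Suc k)))"
    using L assms(2) by (intro finsum_cong') (auto simp: m_ac)
  also have "\<dots> = r \<otimes> (\<Oplus>k\<in>{..n}. r [^] k \<otimes> L (Suc k))"
    using L assms(2) by (intro finsum_rdistr[symmetric]) auto
  also have "(\<Oplus>k\<in>{..n}. r [^] k \<otimes> L (Suc k)) = horner (map (\<lambda>k. L (Suc k)) [0..<Suc n]) r"
    using L by (intro Suc.IH) auto
  also have "map (\<lambda>k. L (Suc k)) [0..<Suc n] = map L [1..<Suc (Suc n)]"
    by (simp only: map_Suc_upt[of 0 "Suc n", symmetric] map_map comp_def One_nat_def)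
  finally have "(\<Oplus>k\<in>{..Suc n}. r [^] k \<otimes> L k) =
      r \<otimes> horner (map L [1..<Suc (Suc n)]) r \<oplus> r [^] (0::nat) \<otimes> L 0" .
  moreover have "horner (map L [1..<Suc (Suc n)]) r \<in> carrier R"
    using L assms(2) by (intro horner_closed) auto
  moreover have "[0..<Suc (Suc n)] = 0 # [1..<Suc (Suc n)]" by (subst upt_conv_Cons) auto
  ultimately show ?case using L[of 0] assms(2) by (simp add: a_comm del: upt_Suc)
qed

text \<open>Subtracting \<open>r * m\<close> from the expansion of \<open>f\<close> along the line leaves \<open>r\<close> times a polynomial with \<open>n\<close>
coefficients, to which the Vandermonde argument applies; all but the first are values of
homogeneous parts of degree at least \<open>2\<close>.\<close>

lemma hom_part_zero_if_affine_linear_on_line: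
  assumes full: "vandermonde_full R n" and n: "1 \<le> n"
    and a: "a \<in> Pow {1..n} \<rightarrow> carrier R"
    and f: "\<And>x. x \<in> vecs R n \<Longrightarrow> f x = (\<Oplus>k\<in>{..n}. hom_part n a k x)"
    and v: "v \<in> vecs R n" and line: "affine_linear_on_line R n f v"
    and k: "2 \<le> k" "k \<le> n"
  shows "hom_part n a k v = \<zero>"
proof -
  define L where "L k = hom_part n a k v" for k
  have L: "L k \<in> carrier R" for k
    unfolding L_def by (intro hom_part_closed coefficients_on_ksubsets a v)
  define cs where "cs = map L [2..<Suc n]"
  have upt: "[0..<Suc n] = 0 # 1 # [2..<Suc n]"
    using n by (simp add: upt_conv_Cons numeral_2_eq_2 del: upt_Suc)
  have cs: "set cs \<subseteq> carrier R" using L by (auto simp: cs_def)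
  have on_line: "f (scale_vec R n r v) = L 0 \<oplus> r \<otimes> (L 1 \<oplus> r \<otimes> horner cs r)" if r: "r \<in> carrier R" for r
  proof -
    have "f (scale_vec R n r v) = (\<Oplus>k\<in>{..n}. r [^] k \<otimes> L k)"
      unfolding f[OF scale_vec_in_vecs[OF r v]] L_def
      using L[unfolded L_def] r a v
      by (intro finsum_cong' hom_part_scale coefficients_on_ksubsets) auto
    also have "\<dots> = horner (map L [0..<Suc n]) r"
      using L r by (intro finsum_powers_eq_horner) auto
    finally show ?thesis unfolding upt cs_def by simp
  qed
  have f0: "f (zero_vec R n) = L 0"
    using on_line[of \<zero>] L horner_closed[OF cs, of \<zero>] by (simp add: scale_vec_zero[OF v])
  obtain m where m: "m \<in> carrier R"
    and lin: "\<And>r. r \<in> carrier R \<Longrightarrow> f (scale_vec R n r v) = f (zero_vec R n) \<oplus> r \<otimes> m"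
    using line unfolding affine_linear_on_line_def by blast
  let ?ds = "(L 1 \<ominus> m) # cs"
  have "vandermonde_value R n x \<otimes> L k = \<zero>" if x: "x \<in> vecs R n" for x
  proof (rule vandermonde_value_annihilates_coeffs)
    show "set ?ds \<subseteq> carrier R" using cs L m by auto
    show "length ?ds = n" using n by (simp add: cs_def) arith
    show "L k \<in> set ?ds" using k by (auto simp: cs_def simp del: upt_Suc)
    show "x \<in> {1..n} \<rightarrow> carrier R" by (rule vecs_closed[OF x])
    fix r assume r: "r \<in> carrier R"
    have h: "horner cs r \<in> carrier R" by (rule horner_closed[OF cs r])
    have "L 0 \<oplus> r \<otimes> (L 1 \<oplus> r \<otimes> horner cs r) = L 0 \<oplus> r \<otimes> m"
      using on_line[OF r] lin[OF r] f0 by simp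
    then have "r \<otimes> (L 1 \<oplus> r \<otimes> horner cs r) = r \<otimes> m" using L m r h by simp
    moreover have "r \<otimes> ((L 1 \<ominus> m) \<oplus> r \<otimes> horner cs r) = r \<otimes> (L 1 \<oplus> r \<otimes> horner cs r) \<ominus> r \<otimes> m"
      using L[of 1] m r h by algebra
    ultimately have "r \<otimes> ((L 1 \<ominus> m) \<oplus> r \<otimes> horner cs r) = \<zero>" using m r by simp
    then show "r \<otimes> horner ?ds r = \<zero>" by simp
  qed
  then have "\<forall>x\<in>vecs R n. L k \<otimes> vandermonde_value R n x = \<zero>"
    using L[of k] vandermonde_value_closed[OF vecs_closed] by (auto simp: m_comm)
  then show ?thesis using full L[of k] unfolding vandermonde_full_iff L_def by blast
qed

lemma affine_linear_if_degree_le_one: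
  assumes n: "1 \<le> n" and a: "a \<in> Pow {1..n} \<rightarrow> carrier R"
    and f: "\<And>x. x \<in> vecs R n \<Longrightarrow> f x = (\<Oplus>k\<in>{..n}. hom_part n a k x)"
    and zero: "\<And>J. J \<subseteq> {1..n} \<Longrightarrow> 2 \<le> card J \<Longrightarrow> a J = \<zero>"
  shows "affine_linear R n f"
proof -
  have val: "f x = a {} \<oplus> (\<Oplus>i\<in>{1..n}. a {i} \<otimes> x i)" if x: "x \<in> vecs R n" for x
  proof -
    have L: "hom_part n a k x \<in> carrier R" for k by (intro hom_part_closed coefficients_on_ksubsets a x)
    have "f x = (\<Oplus>k\<in>{0, 1}. hom_part n a k x)"
      unfolding f[OF x]
    proof (rule add.finprod_mono_neutral_cong_right)
      fix k assume k: "k \<in> {..n} - {0, 1}"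
      show "hom_part n a k x = \<zero>"
        unfolding hom_part_def
      proof (rule add.finprod_one_eqI)
        fix J assume J: "J \<in> ksubsets {1..n} k"
        then have "a J = \<zero>" using k by (intro zero) (auto simp: ksubsets_def)
        then show "a J \<otimes> (\<Otimes>j\<in>J. x j) = \<zero>" using monomial_closed[OF x J] by simp
      qed
    qed (use n L in auto)
    also have "\<dots> = hom_part n a 0 x \<oplus> hom_part n a 1 x" using L by (simp add: finsum_insert)
    also have "hom_part n a 0 x = a {}"
    proof -
      have "ksubsets {1..n} 0 = {{}}"
        unfolding ksubsets_def by (auto simp: card_eq_0_iff dest: finite_subset)
      moreover have "a {} \<in> carrier R" using a by auto
      ultimately show ?thesis by (simp add: hom_part_def finsum_insert)
    qed
    also have "hom_part n a 1 x = (\<Oplus>i\<in>{1..n}. a {i} \<otimes> x i)"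
    proof -
      have single: "ksubsets {1..n} 1 = (\<lambda>i. {i}) ` {1..n}"
        unfolding ksubsets_def by (auto simp: card_1_singleton_iff)
      have xs: "x i \<in> carrier R" if "i \<in> {1..n}" for i using x that by (auto simp: vecs_def)
      have as: "a {i} \<in> carrier R" if "i \<in> {1..n}" for i using a that by auto
      have prod: "(\<Otimes>j\<in>{i}. x j) = x i" if "i \<in> {1..n}" for i using xs[OF that] by simp
      have "hom_part n a 1 x = (\<Oplus>i\<in>{1..n}. a {i} \<otimes> (\<Otimes>j\<in>{i}. x j))"
        unfolding hom_part_def single
        using monomial_closed[OF x, of _ 1] as xs
        by (intro finsum_reindex) (auto simp: prod inj_on_def)
      also have "\<dots> = (\<Oplus>i\<in>{1..n}. a {i} \<otimes> x i)"
        using as xs prod by (intro finsum_cong') auto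
      finally show ?thesis .
    qed
    finally show ?thesis .
  qed
  have "(\<Oplus>i\<in>{1..n}. a {i} \<otimes> zero_vec R n i) = \<zero>"
    using a by (intro add.finprod_one_eqI) (auto simp: zero_vec_def Pi_iff)
  then have "f (zero_vec R n) = a {}" using val[OF zero_vec_in_vecs] a by (simp add: Pi_iff)
  then show ?thesis
    unfolding affine_linear_def using val a by (intro bexI[of _ "\<lambda>i. a {i}"]) auto
qed

lemma affine_linear_on_line_if_affine_linear:
  assumes "affine_linear R n f" and v: "v \<in> vecs R n"
  shows "affine_linear_on_line R n f v"
proof -
  obtain a where a: "a \<in> {1..n} \<rightarrow> carrier R"
    and f: "\<And>x. x \<in> vecs R n \<Longrightarrow> f x = f (zero_vec R n) \<oplus> (\<Oplus>i\<in>{1..n}. a i \<otimes> x i)"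
    using assms(1) unfolding affine_linear_def by blast
  have cl: "a i \<otimes> v i \<in> carrier R" if "i \<in> {1..n}" for i
    using a v that by (auto simp: vecs_def Pi_iff PiE_iff)
  have "f (scale_vec R n r v) = f (zero_vec R n) \<oplus> r \<otimes> (\<Oplus>i\<in>{1..n}. a i \<otimes> v i)"
    if r: "r \<in> carrier R" for r
  proof -
    have "(\<Oplus>i\<in>{1..n}. a i \<otimes> scale_vec R n r v i) = (\<Oplus>i\<in>{1..n}. r \<otimes> (a i \<otimes> v i))"
      using a v r by (intro finsum_cong') (auto simp: scale_vec_def vecs_def m_lcomm Pi_iff PiE_iff)
    also have "\<dots> = r \<otimes> (\<Oplus>i\<in>{1..n}. a i \<otimes> v i)"
      using cl r by (intro finsum_rdistr[symmetric]) auto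
    finally show ?thesis using f[OF scale_vec_in_vecs[OF r v]] by simp
  qed
  then show ?thesis
    unfolding affine_linear_on_line_def using cl
    by (intro bexI[of _ "\<Oplus>i\<in>{1..n}. a i \<otimes> v i"] ballI finsum_closed) auto
qed

lemma affine_linear_if_ballot_directions:
  assumes full: "vandermonde_full R n" and n: "1 \<le> n" and f: "multi_affine R n f"
    and ballot: "\<And>v. v \<in> ballot_directions R n \<Longrightarrow> affine_linear_on_line R n f v"
  shows "affine_linear R n f"
proof -
  obtain a where a: "a \<in> Pow {1..n} \<rightarrow> carrier R"
    and fa: "\<And>x. x \<in> vecs R n \<Longrightarrow> f x = (\<Oplus>k\<in>{..n}. hom_part n a k x)"
    using f unfolding multi_affine_iff_hom_parts by blast
  show ?thesis
  proof (rule affine_linear_if_degree_le_one[OF n a fa])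
    fix J assume J: "J \<subseteq> {1..n}" "2 \<le> card J"
    have le: "card J \<le> n" using card_mono[OF _ J(1)] by simp
    note aJ = coefficients_on_ksubsets[OF a, of "card J"]
    show "a J = \<zero>"
    proof (rule zero_if_ballot_disjoint_sums_zero[OF aJ])
      show "J \<in> ksubsets {1..n} (card J)" using J by (simp add: ksubsets_def)
      fix B assume "ballot_set n B"
      then have dir: "ballot_direction R n B \<in> ballot_directions R n"
        by (simp add: ballot_directions_def)
      have "hom_part n a (card J) (ballot_direction R n B) = \<zero>"
        using ballot_directions_subset_vecs dir ballot J(2) le
        by (intro hom_part_zero_if_affine_linear_on_line[OF full n a fa]) auto
      then show "(\<Oplus>J\<in>ksubsets ({1..n} - B) (card J). a J) = \<zero>"
        unfolding ballot_direction_eq_indicator_vec by (subst (asm) hom_part_indicator_vec[OF aJ]) auto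
    qed
  qed
qed

text \<open>A homogeneous map of degree \<open>k\<close> is affine-linear on \<open>R v\<close> if it vanishes at \<open>v\<close>, and that is one
linear condition on its \<open>n choose k\<close> coefficients.\<close>

lemma fewer_directions_insufficient:
  assumes "\<one> \<noteq> \<zero>" and k: "2 \<le> k" "k \<le> n" and m: "m < n choose k"
    and w: "w \<in> {1..m} \<rightarrow> vecs R n"
  shows "\<exists>f. multi_affine R n f \<and> (\<forall>i\<in>{1..m}. affine_linear_on_line R n f (w i)) \<and>
    \<not> affine_linear R n f"
proof -
  have w': "w i \<in> vecs R n" if "i \<in> {1..m}" for i using w that by auto
  obtain b where b: "b \<in> ksubsets {1..n} k \<rightarrow> carrier R" "\<exists>J\<in>ksubsets {1..n} k. b J \<noteq> \<zero>"
    "\<forall>i\<in>{1..m}. (\<Oplus>J\<in>ksubsets {1..n} k. b J \<otimes> (\<Otimes>j\<in>J. w i j)) = \<zero>"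
    using underdetermined_system[OF assms(1), of "{1..m}" "ksubsets {1..n} k" "\<lambda>i J. \<Otimes>j\<in>J. w i j"]
      monomial_closed[OF w'] m by (auto simp: finite_ksubsets card_ksubsets)
  have "affine_linear_on_line R n (hom_part n b k) (w i)" if i: "i \<in> {1..m}" for i
    using b(1,3) k(1) w'[OF i] i by (intro hom_part_affine_linear_on_line) (auto simp: hom_part_def)
  then show ?thesis
    using hom_part_multi_affine[OF b(1)] hom_part_not_affine_linear[OF b(1) k(1)] b(2) by blast
qed

text \<open>The example is \<open>b x\<^sub>1 \<cdots> x\<^sub>k\<close>: scaling by \<open>r\<close> multiplies it by \<open>r\<^sup>k\<close>, which \<open>b\<close> cannot
distinguish from \<open>r\<close>.\<close>

lemma lines_insufficient_if_powers_agree: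
  assumes b: "b \<in> carrier R" "b \<noteq> \<zero>" and k: "2 \<le> k" "k \<le> n"
    and pow: "\<And>r. r \<in> carrier R \<Longrightarrow> b \<otimes> r [^] k = b \<otimes> r"
  shows "\<exists>f. multi_affine R n f \<and> (\<forall>v\<in>vecs R n. affine_linear_on_line R n f v) \<and>
    \<not> affine_linear R n f"
proof -
  define a where "a J = (if J = {1..k} then b else \<zero>)" for J
  have a: "a \<in> ksubsets {1..n} k \<rightarrow> carrier R" using b by (auto simp: a_def)
  have top: "{1..k} \<in> ksubsets {1..n} k" using k by (auto simp: ksubsets_def)
  have "affine_linear_on_line R n (hom_part n a k) v" if v: "v \<in> vecs R n" for v
  proof (rule hom_part_affine_linear_on_line[OF a _ v])
    show "0 < k" using k by simp
    fix r assume r: "r \<in> carrier R"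
    define p where "p = (\<Otimes>j\<in>{1..k}. v j)"
    have p: "p \<in> carrier R" unfolding p_def by (rule monomial_closed[OF v top])
    have "hom_part n a k v = (\<Oplus>J\<in>ksubsets {1..n} k. if {1..k} = J then b \<otimes> (\<Otimes>j\<in>J. v j) else \<zero>)"
      unfolding hom_part_def using b monomial_closed[OF v]
      by (intro finsum_cong') (auto simp: a_def)
    also have "\<dots> = b \<otimes> p"
      unfolding p_def using b top monomial_closed[OF v]
      by (intro finsum_singleton) (auto simp: finite_ksubsets)
    finally have val: "hom_part n a k v = b \<otimes> p" .
    have "r [^] k \<otimes> (b \<otimes> p) = (b \<otimes> r [^] k) \<otimes> p" using b r p by (simp add: m_ac)
    also have "\<dots> = r \<otimes> (b \<otimes> p)" using b r p by (simp add: pow m_ac)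
    finally show "r [^] k \<otimes> hom_part n a k v = r \<otimes> hom_part n a k v" unfolding val .
  qed
  moreover have "\<not> affine_linear R n (hom_part n a k)"
    using b top by (intro hom_part_not_affine_linear[OF a k(1) top]) (simp add: a_def)
  ultimately show ?thesis using hom_part_multi_affine[OF a] by blast
qed

end


section \<open>Affine-linearity on ballot directions\<close>

theorem theorem2:
  fixes R :: "('a, 'm) ring_scheme" and n N :: nat
  assumes "3 \<le> n"
    and "N = n choose (n div 2)"
    and "cring R"
    and "\<one>\<^bsub>R\<^esub> \<noteq> \<zero>\<^bsub>R\<^esub>"
  shows "card (ballot_directions R n) = N \<and>
    (\<forall>f. multi_affine R n f \<longrightarrow>
      (affine_linear R n f \<longrightarrow> (\<forall>v \<in> vecs R n. affine_linear_on_line R n f v)) \<and>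
      ((\<forall>v \<in> vecs R n. affine_linear_on_line R n f v) \<longrightarrow>
         (\<forall>v \<in> ballot_directions R n. affine_linear_on_line R n f v))) \<and>
    (vandermonde_full R n \<longrightarrow>
      (\<forall>f. multi_affine R n f \<longrightarrow>
        (affine_linear R n f \<longleftrightarrow> (\<forall>v \<in> vecs R n. affine_linear_on_line R n f v)) \<and>
        ((\<forall>v \<in> vecs R n. affine_linear_on_line R n f v) \<longleftrightarrow>
           (\<forall>v \<in> ballot_directions R n. affine_linear_on_line R n f v))) \<and>
      (\<forall>m < N. \<forall>w \<in> {1..m} \<rightarrow> vecs R n.
        \<exists>f. multi_affine R n f \<and> (\<forall>i \<in> {1..m}. affine_linear_on_line R n f (w i)) \<and>
          \<not> affine_linear R n f)) \<and>
    (\<not> vandermonde_full R n \<and> product_of_Q_kasch TYPE('i) TYPE('b) R \<longrightarrow>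
      (\<exists>f. multi_affine R n f \<and> (\<forall>v \<in> vecs R n. affine_linear_on_line R n f v) \<and>
        \<not> affine_linear R n f))"
proof -
  interpret cring R by (rule assms(3))
  have one: "\<one>\<^bsub>R\<^esub> \<noteq> \<zero>\<^bsub>R\<^esub>" by (rule assms(4))
  \<comment> \<open>The upper middle degree, since the lower one is \<open>1\<close> for \<open>n = 3\<close>.\<close>
  define k where "k = n - n div 2"
  have k: "2 \<le> k" "k \<le> n" using assms(1) by (auto simp: k_def)
  have N: "n choose k = N"
    unfolding assms(2) k_def by (rule binomial_symmetric[symmetric]) simp
  have "card (ballot_directions R n) = N"
    using card_ballot_directions[OF one] assms(2) by simp
  moreover have line: "affine_linear_on_line R n f v" if "affine_linear R n f" "v \<in> vecs R n" for f v
    using that by (rule affine_linear_on_line_if_affine_linear)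
  moreover have "v \<in> vecs R n" if "v \<in> ballot_directions R n" for v
    using that ballot_directions_subset_vecs by blast
  moreover have "affine_linear R n f"
    if "vandermonde_full R n" "multi_affine R n f"
      "\<forall>v\<in>ballot_directions R n. affine_linear_on_line R n f v" for f
    using that assms(1) by (intro affine_linear_if_ballot_directions) auto
  moreover have "\<exists>f. multi_affine R n f \<and> (\<forall>i\<in>{1..m}. affine_linear_on_line R n f (w i)) \<and>
      \<not> affine_linear R n f" if "m < N" "w \<in> {1..m} \<rightarrow> vecs R n" for m w
    using fewer_directions_insufficient[OF one k _ that(2)] that(1) N by simp
  moreover have "\<exists>f. multi_affine R n f \<and> (\<forall>v\<in>vecs R n. affine_linear_on_line R n f v) \<and>
      \<not> affine_linear R n f"
    if "\<not> vandermonde_full R n" "product_of_Q_kasch TYPE('i) TYPE('b) R"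
    using product_of_Q_kasch_powers_agree[OF that(2,1)]
      lines_insufficient_if_powers_agree by blast
  ultimately show ?thesis by blast
qed

end
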